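(* Let $n\ge 1$ and $0<p<p_n^*$. The defocusing nonlinear Schrödinger equation $$iu_t+\Delta u=|u|^pu,\qquad (t,x)\in\mathbb{R}\times\mathbb{R}^n,$$ has no breather solution.
   Context: The energy critical power is $p_n^*=\infty$ for $n=1,2$ and $p_n^*=\frac{4}{n-2}$ for $n\ge 3$. Let $Q$ be the ground state, i.e. the unique (up to symmetries) positive radial, exponentially decaying $H^1(\mathbb{R}^n)$ solution of $-\Delta Q+Q-|Q|^pQ=0$. For $\omega>0$ let $Q_\omega(x)=\omega^{1/p}Q(\sqrt{\omega}\,x)$, which solves $-\Delta Q_\omega+\omega Q_\omega-|Q_\omega|^pQ_\omega=0$. Breather (with zero background) of $iu_t+\Delta u=\varepsilon|u|^pu$ (here $\varepsilon=1$): a solution $u:\mathbb{R}\times\mathbb{R}^n\to\mathbb{C}$, not identically zero, for which there exist $\omega,C,\gamma>0$ such that, writing $u(t,x)=e^{i\omega t}\big(Q_\omega(x)+z(t,x)\big)$, the function $z$ is not identically zero (it then solves the perturbed equation $iz_t-\omega z+\Delta z=\varepsilon|Q_\omega+z|^p(Q_\omega+z)+|Q_\omega|^pQ_\omega$) and: (i) $u(t+2\pi/\omega,x)=u(t,x)$ for all $(t,x)\in\mathbb{R}\times\mathbb{R}^n$; (ii) $z(t,\cdot)\in C^\infty(\mathbb{R}^n)\cap H^1(\mathbb{R}^n)$ for all $t\in\mathbb{R}$; (iii) $\sup_{t\in\mathbb{R}}|D_x^\alpha z(t,x)|\le Ce^{-\gamma|x|}$ for all $x\in\mathbb{R}^n$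 and all multi-indices $|\alpha|\le 2$. *)

theory Defs
  imports "HOL-Analysis.Analysis"
begin

definition energy_critical_power :: "nat \<Rightarrow> ereal" where
  "energy_critical_power n = (if n \<le> 2 then \<infinity> else ereal (4 / (real n - 2)))"

definition partial_deriv ::
  "'n::finite \<Rightarrow> (real^'n \<Rightarrow> 'b::real_normed_vector) \<Rightarrow> real^'n \<Rightarrow> 'b" where
  "partial_deriv i f = (\<lambda>x. frechet_derivative f (at x) (axis i 1))"

primrec Ck :: "nat \<Rightarrow> (real^'n::finite \<Rightarrow> 'b::real_normed_vector) \<Rightarrow> bool" where
  "Ck 0 f \<longleftrightarrow> continuous_on UNIV f"
| "Ck (Suc k) f \<longleftrightarrow> f differentiable_on UNIV \<and> (\<forall>i. Ck k (partial_deriv i f))"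

definition smooth :: "(real^'n::finite \<Rightarrow> 'b::real_normed_vector) \<Rightarrow> bool" where
  "smooth f \<longleftrightarrow> (\<forall>k. Ck k f)"

text \<open>
  The list \<open>[i1, ..., ik]\<close> of coordinates stands for the multi-index of order \<open>k\<close> counting
  the occurrences of each coordinate.  Below this is only applied to smooth functions, for
  which the order of differentiation is immaterial.
\<close>
definition multi_deriv ::
  "'n::finite list \<Rightarrow> (real^'n \<Rightarrow> 'b::real_normed_vector) \<Rightarrow> real^'n \<Rightarrow> 'b" where
  "multi_deriv \<alpha> f = foldr partial_deriv \<alpha> f"

definition laplacian ::
  "(real^'n::finite \<Rightarrow> 'b::real_normed_vector) \<Rightarrow> real^'n \<Rightarrow> 'b" where
  "laplacian f x = (\<Sum>i\<in>UNIV. partial_deriv i (partial_deriv i f) x)"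

definition test_function :: "(real^'n::finite \<Rightarrow> real) \<Rightarrow> bool" where
  "test_function \<phi> \<longleftrightarrow> smooth \<phi> \<and> compact (closure {x. \<phi> x \<noteq> 0})"

definition L2_fun :: "(real^'n::finite \<Rightarrow> 'b::euclidean_space) \<Rightarrow> bool" where
  "L2_fun f \<longleftrightarrow> f \<in> borel_measurable lebesgue \<and> integrable lebesgue (\<lambda>x. (norm (f x))\<^sup>2)"

definition weak_partial ::
  "'n::finite \<Rightarrow> (real^'n \<Rightarrow> 'b::euclidean_space) \<Rightarrow> (real^'n \<Rightarrow> 'b) \<Rightarrow> bool" where
  "weak_partial i f g \<longleftrightarrow>
     (\<forall>\<phi>. test_function \<phi> \<longrightarrow>
        (\<integral>x. partial_deriv i \<phi> x *\<^sub>R f x \<partial>lebesgue) = - (\<integral>x. \<phi> x *\<^sub>R g x \<partial>lebesgue))"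

definition H1_fun :: "(real^'n::finite \<Rightarrow> 'b::euclidean_space) \<Rightarrow> bool" where
  "H1_fun f \<longleftrightarrow> L2_fun f \<and> (\<forall>i. \<exists>g. L2_fun g \<and> weak_partial i f g)"

text \<open>
  Solutions of the elliptic equation are taken in the classical sense.  The ground state is
  unique once it is radial about the origin; it enters as a predicate, so neither its
  existence nor its uniqueness is presupposed.
\<close>
definition ground_state :: "real \<Rightarrow> (real^'n::finite \<Rightarrow> real) \<Rightarrow> bool" where
  "ground_state p Q \<longleftrightarrow>
     Ck 2 Q \<and> H1_fun Q \<and>
     (\<forall>x. 0 < Q x) \<and>
     (\<forall>x y. norm x = norm y \<longrightarrow> Q x = Q y) \<and>
     (\<exists>C>0. \<exists>\<gamma>>0. \<forall>x. \<bar>Q x\<bar> \<le> C * exp (- \<gamma> * norm x)) \<and>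
     (\<forall>x. - laplacian Q x + Q x - \<bar>Q x\<bar> powr p * Q x = 0)"

definition scaled_state ::
  "real \<Rightarrow> (real^'n::finite \<Rightarrow> real) \<Rightarrow> real \<Rightarrow> real^'n \<Rightarrow> real" where
  "scaled_state p Q \<omega> x = \<omega> powr (1 / p) * Q (sqrt \<omega> *\<^sub>R x)"

text \<open>
  Global classical solutions of \<open>i u_t + \<Delta> u = |u|^p u\<close>; the time derivative is only required
  to exist pointwise.
\<close>
definition defocusing_NLS_solution ::
  "real \<Rightarrow> (real \<Rightarrow> real^'n::finite \<Rightarrow> complex) \<Rightarrow> bool" where
  "defocusing_NLS_solution p u \<longleftrightarrow>
     (\<forall>t. Ck 2 (u t)) \<and>
     (\<forall>t x. (\<lambda>s. u s x) differentiable (at t) \<and>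
        \<i> * vector_derivative (\<lambda>s. u s x) (at t) + laplacian (u t) x =
          complex_of_real (cmod (u t x) powr p) * u t x)"

definition breather :: "real \<Rightarrow> (real \<Rightarrow> real^'n::finite \<Rightarrow> complex) \<Rightarrow> bool" where
  "breather p u \<longleftrightarrow>
     defocusing_NLS_solution p u \<and> (\<exists>t x. u t x \<noteq> 0) \<and>
     (\<exists>Q z \<omega> C \<gamma>. ground_state p Q \<and> \<omega> > 0 \<and> C > 0 \<and> \<gamma> > 0 \<and>
        (\<forall>t x. u t x = exp (\<i> * complex_of_real (\<omega> * t)) *
                   (complex_of_real (scaled_state p Q \<omega> x) + z t x)) \<and>
        (\<exists>t x. z t x \<noteq> 0) \<and>
        (\<forall>t x. u (t + 2 * pi / \<omega>) x = u t x) \<and>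
        (\<forall>t. smooth (z t) \<and> H1_fun (z t)) \<and>
        (\<forall>\<alpha> t x. length \<alpha> \<le> 2 \<longrightarrow>
           cmod (multi_deriv \<alpha> (z t) x) \<le> C * exp (- \<gamma> * norm x)))"

end

theory Submission
  imports Defs
begin

text \<open>
  Fix one coordinate \<open>k\<close> and consider the truncated virial
  \<open>M(t) = \<integral> x\<^sub>k \<chi>(x/R) \<partial>\<^sub>k u \<bullet> \<i>u\<close>.  For a defocusing solution \<open>M'\<close> is at least
  \<open>p/(p+2) \<integral> \<chi>(x/R) |u|\<^bsup>p+2\<^esup>\<close> up to errors living on the shell \<open>R \<le> |x| \<le> 2R\<close>.
  A breather and its Laplacian decay exponentially, uniformly in time (for the ground state
  the decay of the Laplacian comes from its equation), so a Caccioppoli estimate makes the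
  shell errors vanish as \<open>R \<rightarrow> \<infinity>\<close> without any decay of the gradient of the ground state.
  Since \<open>M\<close> is periodic, \<open>u\<close> must vanish.
\<close>

section \<open>Directional partial derivatives and integration by parts\<close>

text \<open>The weight is localised in all directions but the multiplier differentiates along one
  axis only. The remaining difficulty is regularity in time: u has a time derivative only pointwise,
  and neither that derivative nor the spatial gradient is assumed to be continuous in t. Hence M is
  differentiated through difference quotients and dominated convergence. The time continuity of the
  gradient of z is recovered from that of z and the uniform bound on its second derivatives.
  Finally, the mean value theorem on two pieces of one period takes the place of integrating M', for
  which no integrability in t is at hand.\<close>

definition has_partial :: "'n::finite \<Rightarrow> (real^'n \<Rightarrow> 'b::real_normed_vector) \<Rightarrow> (real^'n \<Rightarrow> 'b) \<Rightarrow> bool" where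
  "has_partial i f g \<longleftrightarrow>
     (\<forall>x. ((\<lambda>s. f (x + s *\<^sub>R axis i 1)) has_vector_derivative g x) (at 0))"

lemma has_partialD:
  "has_partial i f g \<Longrightarrow> ((\<lambda>s. f (x + s *\<^sub>R axis i 1)) has_vector_derivative g x) (at 0)"
  by (simp add: has_partial_def)

lemma has_partial_line:
  assumes "has_partial i f g"
  shows "((\<lambda>s. f (x + s *\<^sub>R axis i 1)) has_vector_derivative g (x + s *\<^sub>R axis i 1)) (at s within S)"
proof -
  have "((\<lambda>r. f ((x + s *\<^sub>R axis i 1) + r *\<^sub>R axis i 1)) has_vector_derivative
          g (x + s *\<^sub>R axis i 1)) (at (s - s))"
    using has_partialD[OF assms] by simp
  then have "((\<lambda>r. f ((x + s *\<^sub>R axis i 1) + r *\<^sub>R axis i 1)) \<circ> (\<lambda>r. r - s) has_vector_derivative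
          1 *\<^sub>R g (x + s *\<^sub>R axis i 1)) (at s)"
    by (intro vector_diff_chain_at) (auto intro!: derivative_eq_intros)
  then have "((\<lambda>s. f (x + s *\<^sub>R axis i 1)) has_vector_derivative g (x + s *\<^sub>R axis i 1)) (at s)"
    by (simp add: o_def algebra_simps)
  then show ?thesis
    by (rule has_vector_derivative_at_within)
qed

lemma has_partial_unique: "has_partial i f g \<Longrightarrow> has_partial i f h \<Longrightarrow> g = h"
  by (auto simp: has_partial_def intro!: ext vector_derivative_unique_at)

lemma has_partial_eq_rhs: "has_partial i f g \<Longrightarrow> (\<And>x. g x = h x) \<Longrightarrow> has_partial i f h"
  by (simp add: has_partial_def)

text \<open>The bridge from the Frechet derivatives of the definitions to derivatives along one
  axis. From here on product and chain rules are one-dimensional, and continuity is supplied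
  separately where an integral needs it.\<close>

lemma has_partial_partial_deriv:
  assumes "f differentiable_on UNIV"
  shows "has_partial i f (partial_deriv i f)"
  unfolding has_partial_def
proof
  fix x
  have "(f has_derivative frechet_derivative f (at x)) (at (x + 0 *\<^sub>R axis i 1))"
    using assms by (simp add: differentiable_on_def frechet_derivative_works[symmetric])
  moreover have "((\<lambda>s::real. x + s *\<^sub>R axis i 1) has_derivative (\<lambda>s. s *\<^sub>R axis i 1)) (at 0)"
    by (auto intro!: derivative_eq_intros)
  ultimately have "(f \<circ> (\<lambda>s. x + s *\<^sub>R axis i 1) has_derivative
      frechet_derivative f (at x) \<circ> (\<lambda>s. s *\<^sub>R axis i 1)) (at 0)"
    using diff_chain_at[of "\<lambda>s::real. x + s *\<^sub>R axis i 1"] by blast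
  moreover have "linear (frechet_derivative f (at x))"
    using assms by (simp add: differentiable_on_def linear_frechet_derivative)
  ultimately show "((\<lambda>s. f (x + s *\<^sub>R axis i 1)) has_vector_derivative partial_deriv i f x) (at 0)"
    by (simp add: has_vector_derivative_def o_def partial_deriv_def linear_scale)
qed

lemma has_partial_add:
  "has_partial i f f' \<Longrightarrow> has_partial i g g' \<Longrightarrow> has_partial i (\<lambda>x. f x + g x) (\<lambda>x. f' x + g' x)"
  by (auto simp: has_partial_def intro: has_vector_derivative_add)

lemma has_partial_diff:
  "has_partial i f f' \<Longrightarrow> has_partial i g g' \<Longrightarrow> has_partial i (\<lambda>x. f x - g x) (\<lambda>x. f' x - g' x)"
  by (auto simp: has_partial_def intro: has_vector_derivative_diff)

lemma has_partial_linear: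
  "bounded_linear h \<Longrightarrow> has_partial i f f' \<Longrightarrow> has_partial i (\<lambda>x. h (f x)) (\<lambda>x. h (f' x))"
  by (auto simp: has_partial_def intro: bounded_linear.has_vector_derivative)

lemma has_partial_bilinear:
  assumes "bounded_bilinear h" "has_partial i f f'" "has_partial i g g'"
  shows "has_partial i (\<lambda>x. h (f x) (g x)) (\<lambda>x. h (f x) (g' x) + h (f' x) (g x))"
  unfolding has_partial_def
proof
  fix x
  show "((\<lambda>s. h (f (x + s *\<^sub>R axis i 1)) (g (x + s *\<^sub>R axis i 1))) has_vector_derivative
          h (f x) (g' x) + h (f' x) (g x)) (at 0)"
    using bounded_bilinear.has_vector_derivative[OF assms(1) has_partialD[OF assms(2)] has_partialD[OF assms(3)], of x x]
    by simp
qed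

lemmas has_partial_inner = has_partial_bilinear[OF bounded_bilinear_inner]
lemmas has_partial_mult = has_partial_bilinear[OF bounded_bilinear_mult]
lemmas has_partial_scaleR = has_partial_bilinear[OF bounded_bilinear_scaleR]

lemma has_partial_sum:
  "(\<And>j. j \<in> S \<Longrightarrow> has_partial i (f j) (f' j)) \<Longrightarrow>
   has_partial i (\<lambda>x. \<Sum>j\<in>S. f j x) (\<lambda>x. \<Sum>j\<in>S. f' j x)"
  by (auto simp: has_partial_def intro!: has_vector_derivative_sum)

lemma has_partial_compose_real:
  assumes "has_partial i f f'" "\<And>x. (h has_real_derivative h' x) (at x)"
  shows "has_partial i (\<lambda>x. h (f x)) (\<lambda>x. h' (f x) * f' x)"
  unfolding has_partial_def
proof
  fix x
  have "((\<lambda>s. f (x + s *\<^sub>R axis i 1)) has_real_derivative f' x) (at 0)"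
    using has_partialD[OF assms(1)] by (simp add: has_real_derivative_iff_has_vector_derivative)
  from DERIV_chain2[OF assms(2) this]
  show "((\<lambda>s. h (f (x + s *\<^sub>R axis i 1))) has_vector_derivative h' (f x) * f' x) (at 0)"
    by (simp add: has_real_derivative_iff_has_vector_derivative)
qed

lemma has_partial_const: "has_partial i (\<lambda>x. c) (\<lambda>x. 0)"
  by (simp add: has_partial_def)

lemma has_partial_component: "has_partial i (\<lambda>x. x $ j) (\<lambda>x. if i = j then 1 else 0)"
proof -
  have "((\<lambda>s::real. x $ j + s * c) has_vector_derivative c) (at 0)" for x :: "real^'a" and c :: real
    by (auto simp flip: has_real_derivative_iff_has_vector_derivative intro!: derivative_eq_intros)
  from this[of _ "if i = j then 1 else 0"] show ?thesis
    by (simp add: has_partial_def axis_def if_distrib cong: if_cong)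
qed

lemma has_partial_scale_arg:
  assumes "has_partial i f f'"
  shows "has_partial i (\<lambda>x. f (c *\<^sub>R x)) (\<lambda>x. c *\<^sub>R f' (c *\<^sub>R x))"
  unfolding has_partial_def
proof
  fix x
  have "((\<lambda>s. f (c *\<^sub>R x + s *\<^sub>R axis i 1)) \<circ> (\<lambda>s. c * s) has_vector_derivative c *\<^sub>R f' (c *\<^sub>R x)) (at 0)"
    using has_partialD[OF assms]
    by (intro vector_diff_chain_at)
       (auto simp flip: has_real_derivative_iff_has_vector_derivative intro!: derivative_eq_intros)
  then show "((\<lambda>s. f (c *\<^sub>R (x + s *\<^sub>R axis i 1))) has_vector_derivative c *\<^sub>R f' (c *\<^sub>R x)) (at 0)"
    by (simp add: o_def algebra_simps)
qed

section \<open>Mean value bounds and dominated convergence for difference quotients\<close>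

lemma vector_derivative_bound:
  fixes f :: "real \<Rightarrow> 'b::real_normed_vector"
  assumes "\<And>s. s \<in> closed_segment a b \<Longrightarrow> (f has_vector_derivative f' s) (at s)"
    and "\<And>s. s \<in> closed_segment a b \<Longrightarrow> norm (f' s) \<le> B"
  shows "norm (f b - f a) \<le> B * \<bar>b - a\<bar>"
proof -
  have "norm (f b - f a) \<le> B * norm (b - a)"
  proof (rule differentiable_bound[of "closed_segment a b" f "\<lambda>s h. h *\<^sub>R f' s"])
    show "(f has_derivative (\<lambda>h. h *\<^sub>R f' s)) (at s within closed_segment a b)"
      if "s \<in> closed_segment a b" for s
      using assms(1)[OF that] by (simp add: has_vector_derivative_def has_derivative_at_withinI)
    show "onorm (\<lambda>h. h *\<^sub>R f' s) \<le> B" if "s \<in> closed_segment a b" for s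
      using assms(2)[OF that] by (simp add: onorm_scaleR_left_lemma onorm_id onorm_scaleR_left[OF bounded_linear_ident])
  qed auto
  then show ?thesis by simp
qed

lemma integral_tendsto_at_0:
  fixes F :: "real \<Rightarrow> 'a::euclidean_space \<Rightarrow> real"
  assumes "\<And>h. F h \<in> borel_measurable borel" "G \<in> borel_measurable borel"
    and "\<And>h x. h \<noteq> 0 \<Longrightarrow> \<bar>h\<bar> < 1 \<Longrightarrow> \<bar>F h x\<bar> \<le> B"
    and "\<And>h x. h \<noteq> 0 \<Longrightarrow> \<bar>h\<bar> < 1 \<Longrightarrow> norm x > r \<Longrightarrow> F h x = 0"
    and "\<And>x. ((\<lambda>h. F h x) \<longlongrightarrow> G x) (at 0)"
  shows "((\<lambda>h. integral\<^sup>L lborel (F h)) \<longlongrightarrow> integral\<^sup>L lborel G) (at 0)"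
proof -
  \<comment> \<open>Passing to the open interval makes |h| < 1 hold for every term of a sequence and
    not just eventually, so the bounds assumed for small nonzero h apply directly.\<close>
  have at: "at 0 within {-1<..<1} = at (0::real)"
    by (rule at_within_open) auto
  have "((\<lambda>h. integral\<^sup>L lborel (F h)) \<longlongrightarrow> integral\<^sup>L lborel G) (at 0 within {-1<..<1})"
    unfolding tendsto_at_iff_sequentially
  proof (intro allI impI)
    fix X :: "nat \<Rightarrow> real"
    assume X: "\<forall>i. X i \<in> {-1<..<1} - {0}" "X \<longlonglongrightarrow> 0"
    have "(\<lambda>n. integral\<^sup>L lborel (F (X n))) \<longlonglongrightarrow> integral\<^sup>L lborel G"
    proof (rule integral_dominated_convergence[where w = "\<lambda>x. indicator (cball 0 r) x *\<^sub>R B"])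
      show "integrable lborel (\<lambda>x::'a. indicator (cball 0 r) x *\<^sub>R B)"
        by (rule borel_integrable_compact) auto
      have "(\<lambda>n. F (X n) x) \<longlonglongrightarrow> G x" for x
      proof -
        have "((\<lambda>h. F h x) \<circ> X) \<longlonglongrightarrow> G x"
          using assms(5)[of x] X unfolding at[symmetric] tendsto_at_iff_sequentially by blast
        then show ?thesis by (simp add: o_def)
      qed
      then show "AE x in lborel. (\<lambda>n. F (X n) x) \<longlonglongrightarrow> G x"
        by simp
      have "\<bar>F (X n) x\<bar> \<le> indicator (cball 0 r) x *\<^sub>R B" for n x
        using assms(3,4)[of "X n" x] X(1) by (auto simp: indicator_def abs_less_iff)
      then show "AE x in lborel. norm (F (X n) x) \<le> indicator (cball 0 r) x *\<^sub>R B" for n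
        by simp
    qed (use assms in auto)
    then show "((\<lambda>h. integral\<^sup>L lborel (F h)) \<circ> X) \<longlonglongrightarrow> integral\<^sup>L lborel G"
      by (simp add: o_def)
  qed
  then show ?thesis
    by (simp only: at)
qed

lemma integrable_compact_support:
  fixes f :: "'a::euclidean_space \<Rightarrow> real"
  assumes "continuous_on UNIV f" "\<And>x. norm x > r \<Longrightarrow> f x = 0"
  shows "integrable lborel f"
proof -
  have "integrable lborel (\<lambda>x. indicator (cball 0 r) x *\<^sub>R f x)"
    using assms(1) by (intro borel_integrable_compact) (auto intro: continuous_on_subset)
  also have "(\<lambda>x. indicator (cball 0 r) x *\<^sub>R f x) = f"
    using assms(2) by (auto simp: indicator_def fun_eq_iff)
  finally show ?thesis .
qed

lemma continuous_bound_cball: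
  fixes f :: "'a::euclidean_space \<Rightarrow> real"
  assumes "continuous_on UNIV f"
  obtains B where "B \<ge> 0" "\<And>x. norm x \<le> r \<Longrightarrow> \<bar>f x\<bar> \<le> B"
proof -
  have "bounded (f ` cball 0 r)"
    using assms by (intro compact_imp_bounded compact_continuous_image) (auto intro: continuous_on_subset)
  then obtain B where "\<forall>y\<in>f ` cball 0 r. norm y \<le> B" "B > 0"
    by (auto simp: bounded_pos)
  then show ?thesis
    by (intro that[of B]) auto
qed

lemma integral_translation:
  fixes f :: "'a::euclidean_space \<Rightarrow> real"
  assumes "f \<in> borel_measurable borel"
  shows "(\<integral>x. f (x + c) \<partial>lborel) = integral\<^sup>L lborel f"
proof -
  have "integral\<^sup>L lborel f = integral\<^sup>L (distr lborel borel ((+) c)) f"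
    by (simp add: lborel_distr_plus)
  also have "\<dots> = (\<integral>x. f (c + x) \<partial>lborel)"
    using assms by (subst integral_distr) auto
  finally show ?thesis by (simp add: add.commute)
qed

text \<open>All integrations by parts rest on this. Translation invariance replaces Fubini: each
  difference quotient of f has integral 0, and the quotients converge to g under a common bound on a
  fixed ball.\<close>

lemma integral_partial_eq_0:
  fixes f g :: "real^'n::finite \<Rightarrow> real"
  assumes "has_partial i f g" and f: "continuous_on UNIV f" and g: "continuous_on UNIV g"
    and supp: "\<And>x. norm x > r \<Longrightarrow> f x = 0"
  shows "integral\<^sup>L lborel g = 0"
proof -
  define e :: "real^'n" where "e = axis i 1"
  have e: "norm e = 1" by (simp add: e_def norm_axis_1)
  \<comment> \<open>For |h| < 1 the quotients live on the ball of radius r + 1, and the segments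
    along which g is evaluated stay within radius r + 2.\<close>
  define F where "F h x = (f (x + h *\<^sub>R e) - f x) / h" for h x
  obtain B where B: "B \<ge> 0" "\<And>x. norm x \<le> r + 2 \<Longrightarrow> \<bar>g x\<bar> \<le> B"
    using continuous_bound_cball[OF g, of "r + 2"] by blast
  have fm [measurable]: "f \<in> borel_measurable borel"
    using f by (rule borel_measurable_continuous_onI)
  have far: "norm (x + s *\<^sub>R e) > r" if "norm x > r + 1" "\<bar>s\<bar> \<le> 1" for x s
    using that e norm_triangle_ineq4[of "x + s *\<^sub>R e" "s *\<^sub>R e"] by auto
  have F0: "F h x = 0" if "\<bar>h\<bar> < 1" "norm x > r + 1" for h x
    using far[of x h] far[of x 0] that supp by (simp add: F_def)
  have "((\<lambda>h. integral\<^sup>L lborel (F h)) \<longlongrightarrow> integral\<^sup>L lborel g) (at 0)"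
  proof (rule integral_tendsto_at_0[where r = "r + 1" and B = B])
    show "\<bar>F h x\<bar> \<le> B" if h: "h \<noteq> 0" "\<bar>h\<bar> < 1" for h x
    proof (cases "norm x > r + 1")
      case True then show ?thesis using F0 h B(1) by simp
    next
      case False
      have "norm (f (x + h *\<^sub>R e) - f (x + 0 *\<^sub>R e)) \<le> B * \<bar>h - 0\<bar>"
      proof (rule vector_derivative_bound)
        fix s assume "s \<in> closed_segment 0 h"
        then have s: "\<bar>s\<bar> \<le> 1" using h by (auto simp: closed_segment_eq_real_ivl split: if_splits)
        show "((\<lambda>s. f (x + s *\<^sub>R e)) has_vector_derivative g (x + s *\<^sub>R e)) (at s)"
          unfolding e_def by (rule has_partial_line[OF assms(1)])
        show "norm (g (x + s *\<^sub>R e)) \<le> B"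
          using False s e norm_triangle_ineq[of x "s *\<^sub>R e"] by (auto intro!: B(2))
      qed
      then show ?thesis using h by (simp add: F_def field_simps)
    qed
    show "((\<lambda>h. F h x) \<longlongrightarrow> g x) (at 0)" for x
      using has_partialD[OF assms(1), of x]
      by (simp add: has_real_derivative_iff_has_vector_derivative[symmetric] DERIV_def F_def e_def)
  qed (use F0 g in \<open>auto simp: F_def[abs_def] borel_measurable_continuous_onI\<close>)
  moreover have "integral\<^sup>L lborel (F h) = 0" for h
  proof -
    have int: "integrable lborel f" using f supp by (rule integrable_compact_support)
    have c: "continuous_on UNIV (\<lambda>x. f (x + h *\<^sub>R e))"
      by (intro continuous_on_compose2[OF f] continuous_intros) auto
    have "f (x + h *\<^sub>R e) = 0" if "norm x > r + \<bar>h\<bar>" for x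
      using that e norm_triangle_ineq4[of "x + h *\<^sub>R e" "h *\<^sub>R e"] by (auto intro!: supp)
    then have "integrable lborel (\<lambda>x. f (x + h *\<^sub>R e))"
      using c by (rule integrable_compact_support[rotated])
    then show ?thesis
      using int integral_translation[OF fm, of "h *\<^sub>R e"]
      by (simp add: F_def[abs_def])
  qed
  ultimately show ?thesis
    by (simp add: tendsto_const_iff)
qed

text \<open>Schwarz's theorem for derivatives along axes. The second difference D over a square of
  side h is evaluated by two mean value arguments in either order, giving nearby points where
  \<open>fij\<close> and \<open>fji\<close> agree; continuity of both then closes the gap.\<close>

lemma has_partial_mixed_unique:
  fixes f :: "real^'n::finite \<Rightarrow> real"
  assumes i: "has_partial i f fi" and j: "has_partial j f fj"
    and ij: "has_partial j fi fij" and ji: "has_partial i fj fji"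
    and cij: "continuous_on UNIV fij" and cji: "continuous_on UNIV fji"
  shows "fij = fji"
proof
  fix x
  define a b :: "real^'n" where "a = axis i 1" and "b = axis j 1"
  have na: "norm a = 1" "norm b = 1" by (auto simp: a_def b_def norm_axis_1)
  have R: "((\<lambda>s. f (y + s *\<^sub>R a)) has_real_derivative fi (y + s *\<^sub>R a)) (at s)"
    "((\<lambda>s. f (y + s *\<^sub>R b)) has_real_derivative fj (y + s *\<^sub>R b)) (at s)"
    "((\<lambda>s. fi (y + s *\<^sub>R b)) has_real_derivative fij (y + s *\<^sub>R b)) (at s)"
    "((\<lambda>s. fj (y + s *\<^sub>R a)) has_real_derivative fji (y + s *\<^sub>R a)) (at s)" for y s
    using has_partial_line[OF i] has_partial_line[OF j] has_partial_line[OF ij] has_partial_line[OF ji]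
    by (simp_all add: has_real_derivative_iff_has_vector_derivative a_def b_def)
  have ex: "\<exists>y z. norm (y - x) < d \<and> norm (z - x) < d \<and> fij y = fji z" if "d > 0" for d
  proof -
    \<comment> \<open>Both intermediate points differ from x by less than h along each of the two
      axes, hence by less than 2 h < d in norm.\<close>
    define h where "h = d / 3"
    have h: "h > 0" using that by (simp add: h_def)
    define D where "D = f (x + h *\<^sub>R a + h *\<^sub>R b) - f (x + h *\<^sub>R a) - f (x + h *\<^sub>R b) + f x"
    have "\<exists>s. 0 < s \<and> s < h \<and> (f ((x + h *\<^sub>R b) + h *\<^sub>R a) - f (x + h *\<^sub>R a)) -
        (f ((x + h *\<^sub>R b) + 0 *\<^sub>R a) - f (x + 0 *\<^sub>R a)) =
        (h - 0) * (fi ((x + h *\<^sub>R b) + s *\<^sub>R a) - fi (x + s *\<^sub>R a))"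
      by (intro MVT2[where f = "\<lambda>s. f ((x + h *\<^sub>R b) + s *\<^sub>R a) - f (x + s *\<^sub>R a)"] h DERIV_diff R)
    then obtain s where s: "0 < s" "s < h" "D = h * (fi ((x + s *\<^sub>R a) + h *\<^sub>R b) - fi (x + s *\<^sub>R a))"
      by (auto simp: D_def algebra_simps)
    have "\<exists>r. 0 < r \<and> r < h \<and> fi ((x + s *\<^sub>R a) + h *\<^sub>R b) - fi ((x + s *\<^sub>R a) + 0 *\<^sub>R b) =
        (h - 0) * fij ((x + s *\<^sub>R a) + r *\<^sub>R b)"
      by (intro MVT2 h R)
    then obtain r where r: "0 < r" "r < h" "D = h * (h * fij ((x + s *\<^sub>R a) + r *\<^sub>R b))"
      using s(3) by auto
    have "\<exists>s. 0 < s \<and> s < h \<and> (f ((x + h *\<^sub>R a) + h *\<^sub>R b) - f (x + h *\<^sub>R b)) -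
        (f ((x + h *\<^sub>R a) + 0 *\<^sub>R b) - f (x + 0 *\<^sub>R b)) =
        (h - 0) * (fj ((x + h *\<^sub>R a) + s *\<^sub>R b) - fj (x + s *\<^sub>R b))"
      by (intro MVT2[where f = "\<lambda>s. f ((x + h *\<^sub>R a) + s *\<^sub>R b) - f (x + s *\<^sub>R b)"] h DERIV_diff R)
    then obtain s' where s': "0 < s'" "s' < h" "D = h * (fj ((x + s' *\<^sub>R b) + h *\<^sub>R a) - fj (x + s' *\<^sub>R b))"
      by (auto simp: D_def algebra_simps)
    have "\<exists>r. 0 < r \<and> r < h \<and> fj ((x + s' *\<^sub>R b) + h *\<^sub>R a) - fj ((x + s' *\<^sub>R b) + 0 *\<^sub>R a) =
        (h - 0) * fji ((x + s' *\<^sub>R b) + r *\<^sub>R a)"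
      by (intro MVT2 h R)
    then obtain r' where r': "0 < r'" "r' < h" "D = h * (h * fji ((x + s' *\<^sub>R b) + r' *\<^sub>R a))"
      using s'(3) by auto
    have "fij ((x + s *\<^sub>R a) + r *\<^sub>R b) = fji ((x + s' *\<^sub>R b) + r' *\<^sub>R a)"
      using r(3) r'(3) h by simp
    moreover have "norm (((x + s *\<^sub>R a) + r *\<^sub>R b) - x) < d"
      using norm_triangle_ineq[of "s *\<^sub>R a" "r *\<^sub>R b"] s r na h by (simp add: h_def)
    moreover have "norm (((x + s' *\<^sub>R b) + r' *\<^sub>R a) - x) < d"
      using norm_triangle_ineq[of "s' *\<^sub>R b" "r' *\<^sub>R a"] s' r' na h by (simp add: h_def)
    ultimately show ?thesis by blast
  qed
  have "\<bar>fij x - fji x\<bar> < e" if "e > 0" for e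
  proof -
    have "isCont fij x" "isCont fji x"
      using cij cji by (auto simp: continuous_on_eq_continuous_at)
    then have "\<exists>d>0. \<forall>y. dist y x < d \<longrightarrow> dist (fij y) (fij x) < e / 2"
        "\<exists>d>0. \<forall>y. dist y x < d \<longrightarrow> dist (fji y) (fji x) < e / 2"
      unfolding continuous_at_eps_delta using half_gt_zero[OF that] by blast+
    then obtain d1 d2 where "d1 > 0" "d2 > 0" and d':
        "\<And>y. dist y x < d1 \<Longrightarrow> dist (fij y) (fij x) < e / 2"
        "\<And>y. dist y x < d2 \<Longrightarrow> dist (fji y) (fji x) < e / 2"
      by auto
    then have d: "d1 > 0" "d2 > 0" "\<And>y. norm (y - x) < d1 \<Longrightarrow> \<bar>fij y - fij x\<bar> < e / 2"
        "\<And>y. norm (y - x) < d2 \<Longrightarrow> \<bar>fji y - fji x\<bar> < e / 2"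
      by (simp_all add: dist_norm)
    obtain y z where "norm (y - x) < min d1 d2" "norm (z - x) < min d1 d2" "fij y = fji z"
      using ex[of "min d1 d2"] d(1,2) by (metis min_less_iff_conj)
    then show ?thesis using d(3)[of y] d(4)[of z] by linarith
  qed
  then show "fij x = fji x"
    using zero_less_abs_iff[of "fij x - fji x"] by (metis eq_iff_diff_eq_0 order_less_irrefl)
qed

section \<open>Virial and Caccioppoli identities\<close>

text \<open>Gradient and Hessian are carried as explicit data, so that formulas for cutoffs and
  breathers can be substituted without computing \<open>partial_deriv\<close>. Index order:
  \<open>H i j\<close> differentiates first along i, then along j.\<close>

definition C2_with ::
  "(real^'n::finite \<Rightarrow> 'b::real_normed_vector) \<Rightarrow> ('n \<Rightarrow> real^'n \<Rightarrow> 'b) \<Rightarrow> ('n \<Rightarrow> 'n \<Rightarrow> real^'n \<Rightarrow> 'b) \<Rightarrow> bool"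
where
  "C2_with f D H \<longleftrightarrow>
     (\<forall>i. has_partial i f (D i)) \<and> (\<forall>i j. has_partial j (D i) (H i j)) \<and>
     continuous_on UNIV f \<and> (\<forall>i. continuous_on UNIV (D i)) \<and> (\<forall>i j. continuous_on UNIV (H i j))"

lemma C2_withD:
  assumes "C2_with f D H"
  shows "has_partial i f (D i)" "has_partial j (D i) (H i j)"
    "continuous_on UNIV f" "continuous_on UNIV (D i)" "continuous_on UNIV (H i j)"
  using assms by (auto simp: C2_with_def)

lemma Ck2_imp_C2_with:
  assumes "Ck 2 f"
  shows "C2_with f (\<lambda>i. partial_deriv i f) (\<lambda>i j. partial_deriv j (partial_deriv i f))"
  using assms unfolding C2_with_def numeral_2_eq_2
  by (auto intro!: has_partial_partial_deriv differentiable_imp_continuous_on)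

lemma C2_with_sym:
  fixes f :: "real^'n::finite \<Rightarrow> 'b::euclidean_space"
  assumes "C2_with f D H"
  shows "H i j x = H j i x"
proof (rule euclidean_eqI)
  fix b :: 'b
  have l: "bounded_linear (\<lambda>y::'b. y \<bullet> b)" by (rule bounded_linear_inner_left)
  have "(\<lambda>x. H i j x \<bullet> b) = (\<lambda>x. H j i x \<bullet> b)"
    by (rule has_partial_mixed_unique[of i "\<lambda>x. f x \<bullet> b" "\<lambda>x. D i x \<bullet> b" j "\<lambda>x. D j x \<bullet> b"];
        intro has_partial_linear[OF l] continuous_intros C2_withD[OF assms])
  then show "H i j x \<bullet> b = H j i x \<bullet> b" by meson
qed

text \<open>The complement of a closed ball is open, so f vanishes on a whole piece of the line
  through x. The strict inequality matters: on the sphere itself this argument says nothing.\<close>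

lemma has_partial_zero_outside:
  assumes "has_partial i f g" "\<And>x. norm x > r \<Longrightarrow> f x = 0" "norm x > r"
  shows "g x = 0"
proof -
  let ?S = "(\<lambda>s. x + s *\<^sub>R axis i 1) -` {x. norm x > r}"
  have "open ?S"
    by (intro open_vimage continuous_intros open_Collect_less)
  then have "((\<lambda>s. f (x + s *\<^sub>R axis i 1)) has_vector_derivative 0) (at 0)"
    by (rule has_vector_derivative_transform_within_open[OF has_vector_derivative_const, of _ 0])
       (use assms in auto)
  with has_partialD[OF assms(1), of x] show ?thesis
    by (rule vector_derivative_unique_at)
qed

section \<open>Differentiating powers of the norm\<close>

lemma has_vector_derivative_quotient:
  fixes v :: "real \<Rightarrow> 'b::real_normed_vector"
  assumes "(v has_vector_derivative d) (at t)"
  shows "((\<lambda>h. (v (t + h) - v t) /\<^sub>R h) \<longlongrightarrow> d) (at 0)"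
proof (rule LIM_zero_cancel)
  have "((\<lambda>h. norm (v (t + h) - v t - h *\<^sub>R d) / norm h) \<longlongrightarrow> 0) (at 0)"
    using assms by (simp add: has_vector_derivative_def has_derivative_at)
  moreover have "eventually (\<lambda>h. norm ((v (t + h) - v t) /\<^sub>R h - d) \<le>
      norm (norm (v (t + h) - v t - h *\<^sub>R d) / norm h) * 1) (at 0)"
  proof -
    have "norm ((v (t + h) - v t) /\<^sub>R h - d) \<le> norm (norm (v (t + h) - v t - h *\<^sub>R d) / norm h) * 1"
      if "h \<noteq> 0" for h
    proof -
      have "(v (t + h) - v t) /\<^sub>R h - d = (v (t + h) - v t - h *\<^sub>R d) /\<^sub>R h"
        using that by (simp add: scaleR_diff_right)
      then show ?thesis by (simp add: divide_inverse mult.commute)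
    qed
    then show ?thesis by (auto simp: eventually_at_filter)
  qed
  ultimately show "((\<lambda>h. (v (t + h) - v t) /\<^sub>R h - d) \<longlongrightarrow> 0) (at 0)"
    by (rule tendsto_0_le)
qed

text \<open>Solutions may have zeros, so the zeros of v need their own argument: there the quotient
  is at most |v(s)/s| |v(s)|^(q-1), whose second factor tends to 0 because q > 1. Elsewhere the norm
  is the square root of the smooth function v \<bullet> v. The stated formula covers both cases,
  since its inner product vanishes at a zero.\<close>

lemma has_real_derivative_norm_powr:
  fixes v :: "real \<Rightarrow> 'b::real_inner"
  assumes v: "(v has_vector_derivative d) (at 0)" and q: "1 < q"
  shows "((\<lambda>s. norm (v s) powr q) has_real_derivative q * norm (v 0) powr (q - 2) * (v 0 \<bullet> d)) (at 0)"
proof (cases "v 0 = 0")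
  case True
  have "((\<lambda>s. norm ((v s - v 0) /\<^sub>R s) * norm (v s) powr (q - 1)) \<longlongrightarrow> norm d * norm (v 0) powr (q - 1)) (at 0)"
  proof (intro tendsto_intros)
    show "((\<lambda>s. (v s - v 0) /\<^sub>R s) \<longlongrightarrow> d) (at 0)"
      using has_vector_derivative_quotient[OF v] by simp
    have "isCont v 0"
      using v by (rule has_vector_derivative_continuous)
    then show "(v \<longlongrightarrow> v 0) (at 0)" by (simp add: isCont_def)
  qed (use q in auto)
  then have "((\<lambda>s. norm ((v s - v 0) /\<^sub>R s) * norm (v s) powr (q - 1)) \<longlongrightarrow> 0) (at 0)"
    by (simp add: True)
  then have "((\<lambda>s. (norm (v (0 + s)) powr q - norm (v 0) powr q) / s) \<longlongrightarrow> 0) (at 0)"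
  proof (rule tendsto_0_le[where K = 1], intro always_eventually allI)
    fix s
    have "norm (v s) powr q = norm (v s) * norm (v s) powr (q - 1)"
      by (simp add: powr_mult_base)
    then show "norm ((norm (v (0 + s)) powr q - norm (v 0) powr q) / s) \<le>
        norm (norm ((v s - v 0) /\<^sub>R s) * norm (v s) powr (q - 1)) * 1"
      using True by (simp add: abs_mult divide_inverse)
  qed
  then show ?thesis
    by (simp add: DERIV_def True)
next
  case False
  have eq: "norm x powr q = (x \<bullet> x) powr (q / 2)" for x :: 'b
    by (simp add: norm_eq_sqrt_inner powr_half_sqrt[symmetric] powr_powr)
  have d: "((\<lambda>s. v s \<bullet> v s) has_real_derivative 2 * (v 0 \<bullet> d)) (at 0)"
    using bounded_bilinear.has_vector_derivative[OF bounded_bilinear_inner v v]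
    by (simp add: has_real_derivative_iff_has_vector_derivative inner_commute)
  have "((\<lambda>s. (v s \<bullet> v s) powr (q / 2)) has_real_derivative
          (q / 2) * (v 0 \<bullet> v 0) powr (q / 2 - 1) * (2 * (v 0 \<bullet> d))) (at 0)"
    using False by (intro DERIV_chain2[where f = "\<lambda>y. y powr (q / 2)", OF has_real_derivative_powr d]) auto
  also have "(v 0 \<bullet> v 0) powr (q / 2 - 1) = norm (v 0) powr (q - 2)"
    by (simp add: norm_eq_sqrt_inner powr_half_sqrt[symmetric] powr_powr diff_divide_distrib)
  finally show ?thesis
    by (simp add: eq mult_ac)
qed

lemma has_partial_norm_powr:
  fixes v :: "real^'n::finite \<Rightarrow> 'b::real_inner"
  assumes "has_partial i v D" "1 < q"
  shows "has_partial i (\<lambda>x. norm (v x) powr q) (\<lambda>x. q * norm (v x) powr (q - 2) * (v x \<bullet> D x))"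
  unfolding has_partial_def
proof
  fix x
  show "((\<lambda>s. norm (v (x + s *\<^sub>R axis i 1)) powr q) has_vector_derivative
      q * norm (v x) powr (q - 2) * (v x \<bullet> D x)) (at 0)"
    using has_real_derivative_norm_powr[OF has_partialD[OF assms(1), of x] assms(2)]
    by (simp add: has_real_derivative_iff_has_vector_derivative)
qed

lemma continuous_on_norm_powr [continuous_intros]:
  fixes v :: "'a::topological_space \<Rightarrow> 'b::real_normed_vector"
  assumes "continuous_on S v" "0 < q"
  shows "continuous_on S (\<lambda>x. norm (v x) powr q)"
  using assms by (intro continuous_on_powr' continuous_intros) auto

text \<open>The common shape of the integrations by parts below: two integrands differ pointwise by
  a sum h of exact derivatives of compactly supported functions.\<close>

lemma integral_eq_up_to_null:
  fixes f g h :: "'a::euclidean_space \<Rightarrow> real"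
  assumes "integrable lborel g" "integrable lborel h" "integral\<^sup>L lborel h = 0"
    and "\<And>x. f x = g x + h x"
  shows "integral\<^sup>L lborel f = integral\<^sup>L lborel g"
proof -
  have "f = (\<lambda>x. g x + h x)" using assms(4) by auto
  then show ?thesis using assms(1-3) by simp
qed

text \<open>With a real weight a, the multiplier \<partial>_k a v + 2 a \<partial>_k v is chosen so
  that every term with two derivatives of v and an undifferentiated a combines into an exact
  derivative. Three such derivatives are removed: \<open>g1\<close> moves \<partial>_j off the
  Laplacian, \<open>g2\<close> is \<partial>_k of a |\<nabla>v|^2, and \<open>g3\<close> is
  \<partial>_k of a |v|^(p+2). Taking 2/(p+2) times \<open>g3\<close> cancels the term a |v|^p v
  \<bullet> \<partial>_k v and leaves 1 - 2/(p+2) = p/(p+2) of the potential term.\<close>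

lemma virial_identity:
  fixes v :: "real^'n::finite \<Rightarrow> 'b::euclidean_space" and a :: "real^'n \<Rightarrow> real"
  assumes v: "C2_with v D H" and a: "C2_with a A B" and supp: "\<And>x. norm x > r \<Longrightarrow> a x = 0"
    and p: "p > 0"
  shows "(\<integral>x. (norm (v x) powr p *\<^sub>R v x - (\<Sum>j\<in>UNIV. H j j x)) \<bullet> (A k x *\<^sub>R v x + (2 * a x) *\<^sub>R D k x) \<partial>lborel)
    = (\<integral>x. (\<Sum>j\<in>UNIV. B k j x * (D j x \<bullet> v x) + 2 * A j x * (D j x \<bullet> D k x))
         + p / (p + 2) * A k x * norm (v x) powr (p + 2) \<partial>lborel)" (is "integral\<^sup>L lborel ?L = integral\<^sup>L lborel ?R")
proof -
  note vD = C2_withD[OF v] and aD = C2_withD[OF a]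
  have A0: "A j x = 0" if "norm x > r" for j x
    using has_partial_zero_outside[OF aD(1) supp that] .
  have B0: "B i j x = 0" if "norm x > r" for i j x
    using has_partial_zero_outside[OF aD(2) A0 that] .
  define f1 where "f1 j x = D j x \<bullet> (A k x *\<^sub>R v x + (2 * a x) *\<^sub>R D k x)" for j x
  define g1 where "g1 j x = H j j x \<bullet> (A k x *\<^sub>R v x + (2 * a x) *\<^sub>R D k x)
    + D j x \<bullet> (A k x *\<^sub>R D j x + B k j x *\<^sub>R v x + (2 * a x) *\<^sub>R H k j x + (2 * A j x) *\<^sub>R D k x)" for j x
  define g2 where "g2 x = a x * (\<Sum>j\<in>UNIV. 2 * (D j x \<bullet> H j k x)) + A k x * (\<Sum>j\<in>UNIV. D j x \<bullet> D j x)" for x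
  define g3 where "g3 x = a x * ((p + 2) * norm (v x) powr p * (v x \<bullet> D k x)) + A k x * norm (v x) powr (p + 2)" for x
  have p1: "has_partial j (f1 j) (g1 j)" for j
    unfolding f1_def
    by (rule has_partial_eq_rhs, rule has_partial_inner[OF vD(2) has_partial_add[OF has_partial_scaleR[OF aD(2) vD(1)]
        has_partial_scaleR[OF has_partial_mult[OF has_partial_const aD(1)] vD(2)]]])
       (simp add: g1_def algebra_simps)
  have p2: "has_partial k (\<lambda>x. a x * (\<Sum>j\<in>UNIV. D j x \<bullet> D j x)) g2"
    by (rule has_partial_eq_rhs, rule has_partial_mult[OF aD(1) has_partial_sum[OF has_partial_inner[OF vD(2) vD(2)]]])
       (simp add: g2_def inner_commute)
  have p3: "has_partial k (\<lambda>x. a x * norm (v x) powr (p + 2)) g3"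
    by (rule has_partial_eq_rhs, rule has_partial_mult[OF aD(1) has_partial_norm_powr[OF vD(1)]])
       (use p in \<open>auto simp: g3_def\<close>)
  have c: "continuous_on UNIV (f1 j)" "continuous_on UNIV (g1 j)" "continuous_on UNIV g2" "continuous_on UNIV g3"
    "continuous_on UNIV (\<lambda>x. a x * (\<Sum>j\<in>UNIV. D j x \<bullet> D j x))"
    "continuous_on UNIV (\<lambda>x. a x * norm (v x) powr (p + 2))" "continuous_on UNIV ?R" for j
    unfolding f1_def g1_def g2_def g3_def
    using p by (auto intro!: continuous_intros vD(3-5) aD(3-5))
  have z: "norm x > r \<Longrightarrow> f1 j x = 0" "norm x > r \<Longrightarrow> g1 j x = 0" "norm x > r \<Longrightarrow> g2 x = 0"
    "norm x > r \<Longrightarrow> g3 x = 0" "norm x > r \<Longrightarrow> ?R x = 0" for x j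
    using supp A0 B0 by (auto simp: f1_def g1_def g2_def g3_def)
  define h where "h x = (\<Sum>j\<in>UNIV. - g1 j x) + g2 x + 2 / (p + 2) * g3 x" for x
  have i1: "integrable lborel (g1 j)" "integrable lborel g2" "integrable lborel g3" "integrable lborel ?R" for j
    using integrable_compact_support[OF c(2) z(2)] integrable_compact_support[OF c(3) z(3)]
      integrable_compact_support[OF c(4) z(4)] integrable_compact_support[OF c(7) z(5)] by auto
  have "integral\<^sup>L lborel (g1 j) = 0" "integral\<^sup>L lborel g2 = 0" "integral\<^sup>L lborel g3 = 0" for j
    using integral_partial_eq_0[OF p1 c(1) c(2) z(1)] integral_partial_eq_0[OF p2 c(5) c(3), of r]
      integral_partial_eq_0[OF p3 c(6) c(4), of r] supp by auto
  with i1 have h: "integrable lborel h" "integral\<^sup>L lborel h = 0"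
    by (auto simp: h_def[abs_def])
  show ?thesis
  proof (rule integral_eq_up_to_null[OF i1(4) h])
    fix x
    \<comment> \<open>\<open>g1\<close> produces \<partial>_j \<partial>_k v and \<open>g2\<close>
      produces \<partial>_k \<partial>_j v; they must be matched.\<close>
    have sym: "H k j x = H j k x" for j by (rule C2_with_sym[OF v])
    have N: "norm (v x) powr (p + 2) = norm (v x) powr p * (v x \<bullet> v x)"
      using p by (simp add: powr_add power2_norm_eq_inner)
    have lin: "s * A k x + 2 * a x * t = p / (p + 2) * A k x * s + 2 / (p + 2) * (a x * ((p + 2) * t) + A k x * s)" for s t x
      using p by (simp add: divide_simps) (simp add: algebra_simps)
    have "?L x = (norm (v x) powr p * (v x \<bullet> v x)) * A k x + 2 * a x * norm (v x) powr p * (v x \<bullet> D k x)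
       - (\<Sum>j\<in>UNIV. H j j x \<bullet> (A k x *\<^sub>R v x + (2 * a x) *\<^sub>R D k x))"
      by (simp only: inner_diff_left inner_sum_left) (simp add: inner_add_right algebra_simps)
    also have "(\<Sum>j\<in>UNIV. H j j x \<bullet> (A k x *\<^sub>R v x + (2 * a x) *\<^sub>R D k x)) =
      (\<Sum>j\<in>UNIV. g1 j x) - (\<Sum>j\<in>UNIV. B k j x * (D j x \<bullet> v x) + 2 * A j x * (D j x \<bullet> D k x)) - g2 x"
      unfolding g1_def g2_def sum_distrib_left sum.distrib[symmetric] sum_subtractf[symmetric]
      by (rule sum.cong) (simp_all add: sym inner_add_right algebra_simps)
    finally show "?L x = ?R x + h x"
      using lin[where s = "norm (v x) powr p * (v x \<bullet> v x)" and t = "norm (v x) powr p * (v x \<bullet> D k x)" and x = x]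
      by (simp add: h_def g3_def N sum_negf mult.assoc)
  qed
qed

text \<open>Trades the gradient for v and its Laplacian, the two quantities with known decay. The
  second term of \<open>f\<close> is there to cancel the cross term \<partial>_j \<psi>
  (\<partial>_j v \<bullet> v), so that no gradient of v survives on the right.\<close>

lemma caccioppoli_identity:
  fixes v :: "real^'n::finite \<Rightarrow> 'b::euclidean_space" and \<psi> :: "real^'n \<Rightarrow> real"
  assumes v: "C2_with v D H" and \<psi>: "C2_with \<psi> P Q" and supp: "\<And>x. norm x > r \<Longrightarrow> \<psi> x = 0"
  shows "(\<integral>x. \<psi> x * (\<Sum>j\<in>UNIV. (norm (D j x))\<^sup>2) \<partial>lborel)
    = (\<integral>x. (\<Sum>j\<in>UNIV. Q j j x) / 2 * (norm (v x))\<^sup>2 - \<psi> x * ((\<Sum>j\<in>UNIV. H j j x) \<bullet> v x) \<partial>lborel)"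
    (is "integral\<^sup>L lborel ?L = integral\<^sup>L lborel ?R")
proof -
  note vD = C2_withD[OF v] and aD = C2_withD[OF \<psi>]
  have P0: "P j x = 0" if "norm x > r" for j x
    using has_partial_zero_outside[OF aD(1) supp that] .
  have Q0: "Q i j x = 0" if "norm x > r" for i j x
    using has_partial_zero_outside[OF aD(2) P0 that] .
  define f where "f j x = \<psi> x * (D j x \<bullet> v x) - P j x / 2 * (v x \<bullet> v x)" for j x
  define g where "g j x = \<psi> x * (H j j x \<bullet> v x + D j x \<bullet> D j x) - Q j j x / 2 * (v x \<bullet> v x)" for j x
  have p: "has_partial j (f j) (g j)" for j
  proof -
    \<comment> \<open>The factor 1/2 is written as a constant function to fit the product
      rule.\<close>
    have "has_partial j (\<lambda>x. \<psi> x * (D j x \<bullet> v x) - (P j x * (1 / 2)) * (v x \<bullet> v x)) (g j)"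
      by (rule has_partial_eq_rhs, rule has_partial_diff[OF has_partial_mult[OF aD(1) has_partial_inner[OF vD(2) vD(1)]]
          has_partial_mult[OF has_partial_mult[OF aD(2) has_partial_const] has_partial_inner[OF vD(1) vD(1)]]])
         (simp add: g_def algebra_simps inner_commute)
    then show ?thesis by (simp add: f_def[abs_def])
  qed
  have c: "continuous_on UNIV (f j)" "continuous_on UNIV (g j)" "continuous_on UNIV ?R" for j
    unfolding f_def g_def by (auto intro!: continuous_intros vD(3-5) aD(3-5))
  have z: "norm x > r \<Longrightarrow> f j x = 0" "norm x > r \<Longrightarrow> g j x = 0" "norm x > r \<Longrightarrow> ?R x = 0" for x j
    using supp P0 Q0 by (auto simp: f_def g_def)
  have i: "integrable lborel (g j)" "integrable lborel ?R" for j
    using integrable_compact_support[OF c(2) z(2)] integrable_compact_support[OF c(3) z(3)] by auto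
  have "integral\<^sup>L lborel (g j) = 0" for j
    using integral_partial_eq_0[OF p c(1) c(2) z(1)] by auto
  with i have h: "integrable lborel (\<lambda>x. \<Sum>j\<in>UNIV. g j x)" "(\<integral>x. (\<Sum>j\<in>UNIV. g j x) \<partial>lborel) = 0"
    by auto
  show ?thesis
  proof (rule integral_eq_up_to_null[OF i(2) h])
    fix x
    show "?L x = ?R x + (\<Sum>j\<in>UNIV. g j x)"
      unfolding g_def power2_norm_eq_inner sum_subtractf sum.distrib sum_distrib_left[symmetric]
        sum_distrib_right[symmetric] sum_divide_distrib[symmetric] inner_sum_left
      by (simp add: algebra_simps)
  qed
qed

section \<open>A plateau function of class C^2 built from truncated cubes\<close>

lemma DERIV_max_power:
  "((\<lambda>s::real. (max 0 s) ^ Suc (Suc n)) has_real_derivative real (Suc (Suc n)) * (max 0 s) ^ Suc n) (at s)"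
proof -
  consider "s < 0" | "s = 0" | "s > 0" by linarith
  then show ?thesis
  proof cases
    case 1
    then have "eventually (\<lambda>x. 0 = (max 0 x) ^ Suc (Suc n)) (nhds s)"
      by (intro eventually_mono[OF eventually_nhds_in_open[of "{..<0}" s]]) auto
    then show ?thesis
      using 1 by (subst DERIV_cong_ev[OF refl _ refl, where g = "\<lambda>x. 0"]) (auto elim!: eventually_mono)
  next
    case 3
    then have "eventually (\<lambda>x. (max 0 x) ^ Suc (Suc n) = x ^ Suc (Suc n)) (nhds s)"
      by (intro eventually_mono[OF eventually_nhds_in_open[of "{0<..}" s]]) (auto simp: max_def)
    moreover have "((\<lambda>x. x ^ Suc (Suc n)) has_real_derivative real (Suc (Suc n)) * max 0 s ^ Suc n) (at s)"
      using 3 DERIV_pow[of "Suc (Suc n)" s UNIV] by (simp add: max_def)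
    ultimately show ?thesis
      using DERIV_cong_ev[OF refl _ refl, of "\<lambda>x. max 0 x ^ Suc (Suc n)" "\<lambda>x. x ^ Suc (Suc n)" s] by blast
  next
    case 2
    have "((\<lambda>h::real. \<bar>h\<bar> ^ Suc n) \<longlongrightarrow> \<bar>0\<bar> ^ Suc n) (at 0)"
      by (intro tendsto_intros)
    then have "((\<lambda>h::real. \<bar>h\<bar> ^ Suc n) \<longlongrightarrow> 0) (at 0)"
      by simp
    then have "((\<lambda>h::real. (max 0 (0 + h) ^ Suc (Suc n) - max 0 0 ^ Suc (Suc n)) / h) \<longlongrightarrow> 0) (at 0)"
    proof (rule tendsto_0_le[where K = 1], intro always_eventually allI)
      fix h :: real
      show "norm ((max 0 (0 + h) ^ Suc (Suc n) - max 0 0 ^ Suc (Suc n)) / h) \<le> norm (\<bar>h\<bar> ^ Suc n) * 1"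
        by (cases "h > 0") auto
    qed
    then show ?thesis
      unfolding 2 DERIV_def by simp
  qed
qed

text \<open>
  With \<open>c s = (max 0 s)\<^sup>3\<close>, which is \<open>C\<^sup>2\<close>, the plateau function is \<open>c (1 - c (s - 1))\<close>.
\<close>
definition plateau :: "real \<Rightarrow> real" where
  "plateau s = max 0 (1 - max 0 (s - 1) ^ 3) ^ 3"

definition plateau' :: "real \<Rightarrow> real" where
  "plateau' s = - 9 * max 0 (1 - max 0 (s - 1) ^ 3) ^ 2 * max 0 (s - 1) ^ 2"

definition plateau'' :: "real \<Rightarrow> real" where
  "plateau'' s = 54 * max 0 (1 - max 0 (s - 1) ^ 3) * max 0 (s - 1) ^ 4
     - 18 * max 0 (1 - max 0 (s - 1) ^ 3) ^ 2 * max 0 (s - 1)"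

lemma DERIV_plateau:
  "(plateau has_real_derivative plateau' s) (at s)" "(plateau' has_real_derivative plateau'' s) (at s)"
proof -
  have d3: "((\<lambda>s::real. max 0 s ^ 3) has_real_derivative 3 * max 0 s ^ 2) (at s)" for s
    using DERIV_max_power[of 1 s] by (simp add: numeral_eq_Suc)
  have d2: "((\<lambda>s::real. max 0 s ^ 2) has_real_derivative 2 * max 0 s) (at s)" for s
    using DERIV_max_power[of 0 s] by (simp add: numeral_eq_Suc)
  have s1: "((\<lambda>s::real. s - 1) has_real_derivative 1) (at s)"
    by (auto intro!: derivative_eq_intros)
  have i: "((\<lambda>s::real. 1 - max 0 (s - 1) ^ 3) has_real_derivative - 3 * max 0 (s - 1) ^ 2) (at s)"
    using DERIV_diff[OF DERIV_const DERIV_chain2[OF d3 s1]] by simp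
  show "(plateau has_real_derivative plateau' s) (at s)"
    unfolding plateau_def[abs_def] plateau'_def
    using DERIV_chain2[OF d3 i] by (simp add: mult.assoc)
  show "(plateau' has_real_derivative plateau'' s) (at s)"
    unfolding plateau'_def[abs_def] plateau''_def
    using DERIV_mult[OF DERIV_cmult[OF DERIV_chain2[OF d2 i], of "-9"] DERIV_chain2[OF d2 s1]]
    by (simp add: algebra_simps power2_eq_square power4_eq_xxxx)
qed

lemma plateau_continuous: "continuous_on S plateau" "continuous_on S plateau'" "continuous_on S plateau''"
  unfolding plateau_def[abs_def] plateau'_def[abs_def] plateau''_def[abs_def]
  by (auto intro!: continuous_intros)

lemma plateau_eq_1: "s \<le> 1 \<Longrightarrow> plateau s = 1"
  by (simp add: plateau_def max_def)

lemma plateau_inner_eq_0: "s \<ge> 2 \<Longrightarrow> max 0 (1 - max 0 (s - 1) ^ 3) = (0::real)"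
  using one_le_power[of "s - 1" 3] by simp

lemma plateau_eq_0: "s \<ge> 2 \<Longrightarrow> plateau s = 0"
  unfolding plateau_def by (subst plateau_inner_eq_0) auto

lemma plateau_bounds: "0 \<le> plateau s" "plateau s \<le> 1"
  by (auto simp: plateau_def intro!: power_le_one)

lemma plateau'_eq_0: "s \<le> 1 \<or> s \<ge> 2 \<Longrightarrow> plateau' s = 0"
  and plateau''_eq_0: "s \<le> 1 \<or> s \<ge> 2 \<Longrightarrow> plateau'' s = 0"
  unfolding plateau'_def plateau''_def by (auto simp: plateau_inner_eq_0 simp del: max_def)

text \<open>All powers involved lie between 0 and 1 in the transition zone 1 < s < 2, so 72 = 54 +
  18 bounds the second derivative; the first, bounded by 9, shares this constant for
  simplicity.\<close>

lemma plateau_deriv_bounds: "\<bar>plateau' s\<bar> \<le> 72" "\<bar>plateau'' s\<bar> \<le> 72"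
proof -
  have *: "\<bar>plateau' s\<bar> \<le> 72 \<and> \<bar>plateau'' s\<bar> \<le> 72"
  proof (cases "s \<le> 1 \<or> s \<ge> 2")
    case True then show ?thesis by (simp add: plateau'_eq_0 plateau''_eq_0)
  next
    case False
    define x y where "x = max 0 (s - 1)" and "y = max 0 (1 - x ^ 3)"
    have xy: "0 \<le> x" "x \<le> 1" "0 \<le> y" "y \<le> 1"
      using False by (auto simp: x_def y_def)
    have "0 \<le> y^2 * x^2" "y^2 * x^2 \<le> 1" "0 \<le> y * x^4" "y * x^4 \<le> 1" "0 \<le> y^2 * x" "y^2 * x \<le> 1"
      using xy by (auto intro!: mult_le_one power_le_one)
    moreover have "plateau' s = - 9 * (y^2 * x^2)" "plateau'' s = 54 * (y * x^4) - 18 * (y^2 * x)"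
      by (simp_all add: plateau'_def plateau''_def y_def x_def)
    ultimately show ?thesis by linarith
  qed
  then show "\<bar>plateau' s\<bar> \<le> 72" "\<bar>plateau'' s\<bar> \<le> 72" by auto
qed

section \<open>Cutoff functions\<close>

lemma has_partial_norm_sq: "has_partial i (\<lambda>x. x \<bullet> x) (\<lambda>x. 2 * x $ i)"
proof -
  have "has_partial i (\<lambda>x. x) (\<lambda>x. axis i 1)"
    unfolding has_partial_def
    by (auto simp: has_vector_derivative_def intro!: derivative_eq_intros)
  from has_partial_inner[OF this this] show ?thesis
    by (rule has_partial_eq_rhs) (simp add: inner_axis inner_axis')
qed

text \<open>The argument is |x|^2 / R^2 and not |x| / R, which avoids the singularity of the norm at
  the origin. The cutoff reaches 0 already where |x|^2 = 2 R^2; the rounder radius 2 R is used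
  throughout. Writing 1 / R^2 as a factor suits the product rule.\<close>

definition cutoff :: "real \<Rightarrow> real^'n::finite \<Rightarrow> real" where
  "cutoff R x = plateau ((x \<bullet> x) * (1 / R\<^sup>2))"

definition cutoff1 :: "real \<Rightarrow> 'n \<Rightarrow> real^'n::finite \<Rightarrow> real" where
  "cutoff1 R i x = plateau' ((x \<bullet> x) * (1 / R\<^sup>2)) * (2 * x $ i * (1 / R\<^sup>2))"

definition cutoff2 :: "real \<Rightarrow> 'n \<Rightarrow> 'n \<Rightarrow> real^'n::finite \<Rightarrow> real" where
  "cutoff2 R i j x = plateau' ((x \<bullet> x) * (1 / R\<^sup>2)) * (2 * (if j = i then 1 else 0) * (1 / R\<^sup>2))
     + plateau'' ((x \<bullet> x) * (1 / R\<^sup>2)) * (2 * x $ j * (1 / R\<^sup>2)) * (2 * x $ i * (1 / R\<^sup>2))"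

lemma C2_with_cutoff: "C2_with (cutoff R :: real^'n::finite \<Rightarrow> real) (cutoff1 R) (cutoff2 R)"
proof -
  have s: "has_partial i (\<lambda>x. (x \<bullet> x) * (1 / R\<^sup>2)) (\<lambda>x::real^'n. 2 * x $ i * (1 / R\<^sup>2))" for i
    by (rule has_partial_eq_rhs, rule has_partial_mult[OF has_partial_norm_sq has_partial_const]) simp
  have "has_partial i (cutoff R) (cutoff1 R i)" for i :: 'n
    unfolding cutoff_def[abs_def] cutoff1_def[abs_def]
    by (rule has_partial_compose_real[OF s DERIV_plateau(1)])
  moreover have "has_partial j (cutoff1 R i) (cutoff2 R i j)" for i j :: 'n
    unfolding cutoff1_def[abs_def]
    by (rule has_partial_eq_rhs, rule has_partial_mult[OF has_partial_compose_real[OF s DERIV_plateau(2)]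
      has_partial_mult[OF has_partial_mult[OF has_partial_const has_partial_component] has_partial_const]])
      (simp add: cutoff2_def)
  moreover have "continuous_on UNIV (cutoff R :: real^'n \<Rightarrow> real)"
    "continuous_on UNIV (cutoff1 R i)" "continuous_on UNIV (cutoff2 R i j)" for i j :: 'n
    unfolding cutoff_def cutoff1_def cutoff2_def
    by (intro continuous_intros plateau_continuous[THEN continuous_on_compose2, OF _ subset_UNIV])+
  ultimately show ?thesis
    by (simp add: C2_with_def)
qed

lemma scaled_norm_sq_le_1: "R > 0 \<Longrightarrow> norm x \<le> R \<Longrightarrow> (x \<bullet> x) * (1 / R\<^sup>2) \<le> 1"
  using power_mono[of "norm x" R 2] by (simp add: power2_norm_eq_inner)

lemma scaled_norm_sq_ge_2: "R > 0 \<Longrightarrow> norm x \<ge> 2 * R \<Longrightarrow> (x \<bullet> x) * (1 / R\<^sup>2) \<ge> 2"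
proof -
  assume R: "R > 0" "norm x \<ge> 2 * R"
  then have "4 * R\<^sup>2 \<le> x \<bullet> x"
    using power_mono[of "2 * R" "norm x" 2] by (simp add: power2_norm_eq_inner power_mult_distrib)
  then have "2 * R\<^sup>2 \<le> x \<bullet> x"
    using zero_le_power2[of R] by linarith
  then show ?thesis
    using R by (simp add: pos_le_divide_eq)
qed

lemma cutoff_eq: "R > 0 \<Longrightarrow> norm x \<le> R \<Longrightarrow> cutoff R x = 1" "R > 0 \<Longrightarrow> norm x \<ge> 2 * R \<Longrightarrow> cutoff R x = 0"
  unfolding cutoff_def by (auto intro!: plateau_eq_1 plateau_eq_0 scaled_norm_sq_le_1 scaled_norm_sq_ge_2 simp del: times_divide_eq_right mult_1_right)

lemma cutoff_bounds: "0 \<le> cutoff R x" "cutoff R x \<le> 1"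
  by (auto simp: cutoff_def plateau_bounds)

lemma cutoff_deriv_eq_0:
  assumes "R > 0" "norm x \<le> R \<or> norm x \<ge> 2 * R"
  shows "cutoff1 R i x = 0" "cutoff2 R i j x = 0"
proof -
  have "plateau' ((x \<bullet> x) * (1 / R\<^sup>2)) = 0" "plateau'' ((x \<bullet> x) * (1 / R\<^sup>2)) = 0"
    using assms scaled_norm_sq_le_1[of R x] scaled_norm_sq_ge_2[of R x]
    by (auto intro!: plateau'_eq_0 plateau''_eq_0 simp del: times_divide_eq_right mult_1_right)
  then show "cutoff1 R i x = 0" "cutoff2 R i j x = 0"
    by (simp_all add: cutoff1_def cutoff2_def)
qed

text \<open>In the transition zone every coordinate is at most 2 R, so the inner derivative is at
  most 4 / R. The constants are 288 = 72 * 4 and 1296 = 72 * 2 + 72 * 4 * 4.\<close>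

lemma cutoff_deriv_bounds:
  assumes "R > 0"
  shows "\<bar>cutoff1 R i x\<bar> \<le> 288 / R" "\<bar>cutoff2 R i j x\<bar> \<le> 1296 / R\<^sup>2"
proof -
  have *: "\<bar>cutoff1 R i x\<bar> \<le> 288 / R \<and> \<bar>cutoff2 R i j x\<bar> \<le> 1296 / R\<^sup>2"
  proof (cases "norm x \<le> R \<or> norm x \<ge> 2 * R")
    case True
    then show ?thesis using assms cutoff_deriv_eq_0[OF assms True] by simp
  next
    case False
    have x: "\<bar>2 * x $ l * (1 / R\<^sup>2)\<bar> \<le> 4 / R" for l
    proof -
      have "\<bar>x $ l\<bar> \<le> 2 * R" using component_le_norm_cart[of x l] False by linarith
      then have "\<bar>2 * x $ l * (1 / R\<^sup>2)\<bar> \<le> 2 * (2 * R) * (1 / R\<^sup>2)"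
        using assms by (auto simp: abs_mult intro!: divide_right_mono)
      also have "\<dots> = 4 / R" using assms by (simp add: power2_eq_square)
      finally show ?thesis .
    qed
    have "\<bar>cutoff1 R i x\<bar> \<le> 72 * (4 / R)"
      unfolding cutoff1_def abs_mult[of "plateau' _"]
      using plateau_deriv_bounds x assms by (intro mult_mono) auto
    moreover have "\<bar>cutoff2 R i j x\<bar> \<le> 72 * (2 * (1 / R\<^sup>2)) + 72 * (4 / R) * (4 / R)"
    proof -
      have "\<bar>plateau' ((x \<bullet> x) * (1 / R\<^sup>2)) * (2 * (if j = i then 1 else 0) * (1 / R\<^sup>2))\<bar> \<le> 72 * (2 * (1 / R\<^sup>2))"
        unfolding abs_mult[of "plateau' _"]
        using plateau_deriv_bounds assms by (intro mult_mono) auto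
      moreover have "\<bar>plateau'' ((x \<bullet> x) * (1 / R\<^sup>2)) * (2 * x $ j * (1 / R\<^sup>2)) * (2 * x $ i * (1 / R\<^sup>2))\<bar>
          \<le> 72 * (4 / R) * (4 / R)"
        unfolding abs_mult[of "plateau'' _"] abs_mult[of "plateau'' _ * _"]
        using plateau_deriv_bounds x assms by (intro mult_mono) auto
      ultimately show ?thesis unfolding cutoff2_def by linarith
    qed
    moreover have "72 * (2 * (1 / R\<^sup>2)) + 72 * (4 / R) * (4 / R) = 1296 / R\<^sup>2"
      using assms by (simp add: power2_eq_square)
    ultimately show ?thesis by simp
  qed
  then show "\<bar>cutoff1 R i x\<bar> \<le> 288 / R" "\<bar>cutoff2 R i j x\<bar> \<le> 1296 / R\<^sup>2" by auto
qed

section \<open>The virial weight and the shell that carries its errors\<close>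

definition weight :: "'n \<Rightarrow> real \<Rightarrow> real^'n::finite \<Rightarrow> real" where
  "weight k R x = x $ k * cutoff R x"

definition weight1 :: "'n \<Rightarrow> real \<Rightarrow> 'n \<Rightarrow> real^'n::finite \<Rightarrow> real" where
  "weight1 k R i x = x $ k * cutoff1 R i x + (if i = k then 1 else 0) * cutoff R x"

definition weight2 :: "'n \<Rightarrow> real \<Rightarrow> 'n \<Rightarrow> 'n \<Rightarrow> real^'n::finite \<Rightarrow> real" where
  "weight2 k R i j x = x $ k * cutoff2 R i j x + (if j = k then 1 else 0) * cutoff1 R i x
     + (if i = k then 1 else 0) * cutoff1 R j x"

lemma C2_with_weight: "C2_with (weight k R) (weight1 k R) (weight2 k R)"
proof -
  note c = C2_withD[OF C2_with_cutoff]
  have "has_partial i (weight k R) (weight1 k R i)" for i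
    unfolding weight_def[abs_def] weight1_def[abs_def]
    by (rule has_partial_mult[OF has_partial_component c(1)])
  moreover have "has_partial j (weight1 k R i) (weight2 k R i j)" for i j
    unfolding weight1_def[abs_def]
    by (rule has_partial_eq_rhs, rule has_partial_add[OF has_partial_mult[OF has_partial_component c(2)]
        has_partial_mult[OF has_partial_const c(1)]]) (simp add: weight2_def)
  moreover have "continuous_on UNIV (weight k R)" "continuous_on UNIV (weight1 k R i)"
    "continuous_on UNIV (weight2 k R i j)" for i j
    unfolding weight_def weight1_def weight2_def by (intro continuous_intros c(3-5); simp)+
  ultimately show ?thesis
    by (simp add: C2_with_def)
qed

text \<open>A C^2 bump that equals 1 where the derivatives of \<open>cutoff R\<close> can be
  nonzero, so that it can serve as test function in the Caccioppoli identity. It is nonnegative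
  because the outer cutoff is still 1 wherever the inner one has not vanished.\<close>

definition shell :: "real \<Rightarrow> real^'n::finite \<Rightarrow> real" where
  "shell R x = cutoff (2 * R) x - cutoff (R / 2) x"

definition shell1 :: "real \<Rightarrow> 'n \<Rightarrow> real^'n::finite \<Rightarrow> real" where
  "shell1 R i x = cutoff1 (2 * R) i x - cutoff1 (R / 2) i x"

definition shell2 :: "real \<Rightarrow> 'n \<Rightarrow> 'n \<Rightarrow> real^'n::finite \<Rightarrow> real" where
  "shell2 R i j x = cutoff2 (2 * R) i j x - cutoff2 (R / 2) i j x"

lemma C2_with_shell: "C2_with (shell R) (shell1 R) (shell2 R)"
  unfolding C2_with_def shell_def[abs_def] shell1_def[abs_def] shell2_def[abs_def]
  by (auto intro!: has_partial_diff continuous_on_diff C2_withD[OF C2_with_cutoff])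

lemma shell_eq:
  assumes "R > 0"
  shows "R \<le> norm x \<Longrightarrow> norm x \<le> 2 * R \<Longrightarrow> shell R x = 1"
    "norm x \<le> R / 2 \<or> norm x \<ge> 4 * R \<Longrightarrow> shell R x = 0"
    "norm x \<le> R / 2 \<or> norm x \<ge> 4 * R \<Longrightarrow> shell2 R i j x = 0"
  using assms by (auto simp: shell_def shell2_def cutoff_eq cutoff_deriv_eq_0)

lemma shell_bounds:
  assumes "R > 0"
  shows "0 \<le> shell R x" "shell R x \<le> 1"
proof -
  have "0 \<le> shell R x"
  proof (cases "norm x \<le> 2 * R")
    case True then show ?thesis using assms cutoff_bounds[of "R / 2" x] by (simp add: shell_def cutoff_eq)
  next
    case False then show ?thesis using assms cutoff_bounds[of "2 * R" x] by (simp add: shell_def cutoff_eq)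
  qed
  then show "0 \<le> shell R x" "shell R x \<le> 1"
    using cutoff_bounds[of "2 * R" x] cutoff_bounds[of "R / 2" x] by (auto simp: shell_def)
qed

text \<open>The two radii contribute 1296 / 4 = 324 and 1296 * 4 = 5184, whose sum is rounded up to
  6000.\<close>

lemma shell2_bound: "R \<ge> 1 \<Longrightarrow> \<bar>shell2 R i j x\<bar> \<le> 6000"
proof -
  assume R: "R \<ge> 1"
  have "1296 / (2 * R)\<^sup>2 \<le> 324" "1296 / (R / 2)\<^sup>2 \<le> 5184"
    using R one_le_power[of R 2] by (auto simp: power_mult_distrib power_divide divide_simps)
  then show ?thesis
    using R cutoff_deriv_bounds(2)[of "2 * R" i j x] cutoff_deriv_bounds(2)[of "R / 2" i j x]
    by (auto simp: shell2_def)
qed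

text \<open>The factor x_k, of size 2 R, is absorbed by the decay in R of the cutoff derivatives.
  This gives 576 = 2 * 288 and 3168 = 2 * 1296 + 2 * 288. Multiplying by the shell is free, since it
  equals 1 where these terms live.\<close>

lemma weight_bounds:
  assumes "R \<ge> 1"
  shows "\<bar>x $ k * cutoff1 R i x\<bar> \<le> 576 * shell R x" "\<bar>weight2 k R i j x\<bar> \<le> 3168 * shell R x"
proof -
  have *: "\<bar>x $ k * cutoff1 R i x\<bar> \<le> 576 * shell R x \<and> \<bar>weight2 k R i j x\<bar> \<le> 3168 * shell R x"
  proof (cases "norm x \<le> R \<or> norm x \<ge> 2 * R")
    case True
    have z: "cutoff1 R l x = 0" "cutoff2 R l m x = 0" for l m
      using assms True by (auto intro!: cutoff_deriv_eq_0)
    show ?thesis using assms shell_bounds(1)[of R x] by (simp add: weight2_def z)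
  next
    case False
    have xk: "\<bar>x $ k\<bar> \<le> 2 * R" using component_le_norm_cart[of x k] False by linarith
    have s: "shell R x = 1" using False assms by (auto intro!: shell_eq)
    have R: "R > 0" using assms by simp
    have 1: "\<bar>x $ k * cutoff1 R i x\<bar> \<le> 2 * R * (288 / R)"
      unfolding abs_mult by (intro mult_mono xk cutoff_deriv_bounds) (use assms in auto)
    have 2: "\<bar>x $ k * cutoff2 R i j x\<bar> \<le> 2 * R * (1296 / R\<^sup>2)"
      unfolding abs_mult by (intro mult_mono xk cutoff_deriv_bounds) (use assms in auto)
    have 3: "\<bar>(if b then 1 else 0) * cutoff1 R l x\<bar> \<le> 288" for b l
    proof -
      have "288 / R \<le> 288" using assms by (simp add: divide_simps)
      then show ?thesis using cutoff_deriv_bounds(1)[OF R, of l x] by auto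
    qed
    have "2 * R * (1296 / R\<^sup>2) \<le> 2592" using assms by (simp add: power2_eq_square divide_simps)
    then have "\<bar>weight2 k R i j x\<bar> \<le> 3168"
      using 2 3[of "j = k" i] 3[of "i = k" j] unfolding weight2_def by linarith
    then show ?thesis using 1 assms by (simp add: s)
  qed
  then show "\<bar>x $ k * cutoff1 R i x\<bar> \<le> 576 * shell R x" "\<bar>weight2 k R i j x\<bar> \<le> 3168 * shell R x" by auto
qed

section \<open>Volume growth against exponential decay\<close>

lemma integral_le_ball:
  fixes f :: "'a::euclidean_space \<Rightarrow> real"
  assumes "continuous_on UNIV f" "\<And>x. norm x > r \<Longrightarrow> f x = 0" "\<And>x. f x \<le> M" "0 \<le> r" 
  shows "integral\<^sup>L lborel f \<le> M * (unit_ball_vol (real DIM('a)) * r ^ DIM('a))"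
proof -
  have i: "integrable lborel (\<lambda>x::'a. indicator (cball 0 r) x *\<^sub>R M)"
    by (rule borel_integrable_compact) auto
  have f: "integrable lborel f"
    using assms(1,2) by (rule integrable_compact_support)
  have "integral\<^sup>L lborel f \<le> integral\<^sup>L lborel (\<lambda>x::'a. indicator (cball 0 r) x *\<^sub>R M)"
  proof (rule Bochner_Integration.integral_mono[OF f i])
    show "f x \<le> indicator (cball 0 r) x *\<^sub>R M" for x
      using assms(2)[of x] assms(3)[of x] by (cases "norm x > r") (auto simp: indicator_def)
  qed
  also have "\<dots> = measure lborel (cball (0::'a) r) * M"
    by simp
  also have "measure lborel (cball (0::'a) r) = unit_ball_vol (real DIM('a)) * r ^ DIM('a)"
    using assms(4) content_cball[of r "0::'a"] by simp
  finally show ?thesis by (simp add: mult.commute)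
qed

lemma power_times_exp_tendsto_0:
  assumes "\<gamma> > 0"
  shows "((\<lambda>R::real. exp (- \<gamma> * R) * (K * R) ^ n) \<longlongrightarrow> 0) at_top"
proof -
  have "((\<lambda>R. (\<gamma> * R) ^ n / exp (\<gamma> * R)) \<longlongrightarrow> 0) at_top"
    by (rule filterlim_compose[OF tendsto_power_div_exp_0])
       (use assms in \<open>auto intro!: filterlim_tendsto_pos_mult_at_top[OF tendsto_const] filterlim_ident\<close>)
  then have "((\<lambda>R. (K / \<gamma>) ^ n * ((\<gamma> * R) ^ n / exp (\<gamma> * R))) \<longlongrightarrow> (K / \<gamma>) ^ n * 0) at_top"
    by (intro tendsto_intros)
  moreover have "(K / \<gamma>) ^ n * ((\<gamma> * R) ^ n / exp (\<gamma> * R)) = exp (- \<gamma> * R) * (K * R) ^ n" for R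
    using assms by (simp add: exp_minus power_mult_distrib field_simps)
  ultimately show ?thesis by simp
qed

section \<open>Lower bound for the virial derivative\<close>

text \<open>Here v and d j stand for the values of the function and its gradient at x, N for
  |v|^(p+2) and c for p/(p+2). Summed over j, the errors carry at most 1584 + 1152 = 2736 times n
  for the gradient, 1584 n for |v|^2 and 576 n for N; 4000 n covers all three.\<close>

lemma virial_integrand_bound:
  fixes v :: "'b::real_inner" and d :: "'n::finite \<Rightarrow> 'b" and x :: "real^'n"
  assumes R: "R \<ge> 1" and c: "0 \<le> c" "c \<le> 1" and N: "N \<ge> 0"
  shows "c * (cutoff R x * N) - 4000 * real CARD('n) * (shell R x * (\<Sum>j\<in>UNIV. (norm (d j))\<^sup>2)
      + shell R x * (norm v)\<^sup>2 + shell R x * N)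
    \<le> (\<Sum>j\<in>UNIV. weight2 k R k j x * (d j \<bullet> v) + 2 * weight1 k R j x * (d j \<bullet> d k)) + c * weight1 k R k x * N"
proof -
  define s n S where "s = shell R x" and "n = real CARD('n)" and "S = (\<Sum>j\<in>UNIV. (norm (d j))\<^sup>2)"
  have s: "s \<ge> 0" using R shell_bounds(1)[of R x] by (simp add: s_def)
  have n: "n \<ge> 1" by (simp add: n_def Suc_le_eq)
  have S: "S \<ge> 0" by (simp add: S_def sum_nonneg)
  have dS: "(norm (d j))\<^sup>2 \<le> S" for j
    unfolding S_def by (rule member_le_sum) auto
  have amgm: "\<bar>a \<bullet> b\<bar> \<le> ((norm a)\<^sup>2 + (norm b)\<^sup>2) / 2" for a b :: 'b
  proof -
    have "2 * (norm a * norm b) \<le> (norm a)\<^sup>2 + (norm b)\<^sup>2"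
      using sum_squares_bound[of "norm a" "norm b"] by (simp add: mult.assoc)
    then have "norm a * norm b \<le> ((norm a)\<^sup>2 + (norm b)\<^sup>2) / 2"
      by simp
    with Cauchy_Schwarz_ineq2[of a b] show ?thesis
      by (rule order_trans)
  qed
  have b1: "- (3168 * s * (((norm (d j))\<^sup>2 + (norm v)\<^sup>2) / 2)) \<le> weight2 k R k j x * (d j \<bullet> v)" for j
  proof -
    have "\<bar>weight2 k R k j x * (d j \<bullet> v)\<bar> \<le> 3168 * s * (((norm (d j))\<^sup>2 + (norm v)\<^sup>2) / 2)"
      unfolding abs_mult using s amgm weight_bounds(2)[OF R] by (intro mult_mono) (auto simp: s_def)
    then show ?thesis by linarith
  qed
  have b2: "- (576 * s * S) \<le> (x $ k * cutoff1 R j x) * (d j \<bullet> d k)" for j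
  proof -
    have "\<bar>(x $ k * cutoff1 R j x) * (d j \<bullet> d k)\<bar> \<le> 576 * s * S"
      unfolding abs_mult[of "_ * _"] using s amgm[of "d j" "d k"] dS[of j] dS[of k] weight_bounds(1)[OF R]
      by (intro mult_mono) (auto simp: s_def)
    then show ?thesis by linarith
  qed
  \<comment> \<open>The main gradient term: it is nonzero only for j = k, where it is a cutoff times
    a square. It is discarded by sign, not estimated.\<close>
  have nn: "0 \<le> (if j = k then 1 else 0) * cutoff R x * (d j \<bullet> d k)" for j
    using cutoff_bounds(1)[of R x] by auto
  have "- (3168 * s * (((norm (d j))\<^sup>2 + (norm v)\<^sup>2) / 2)) - 1152 * s * S
     \<le> weight2 k R k j x * (d j \<bullet> v) + 2 * weight1 k R j x * (d j \<bullet> d k)" for j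
  proof -
    have "2 * weight1 k R j x * (d j \<bullet> d k) = 2 * ((x $ k * cutoff1 R j x) * (d j \<bullet> d k))
        + 2 * ((if j = k then 1 else 0) * cutoff R x * (d j \<bullet> d k))"
      by (simp only: weight1_def distrib_left distrib_right mult.assoc)
    moreover have "1152 * s * S = 2 * (576 * s * S)" by simp
    ultimately show ?thesis
      using b1[of j] b2[of j] nn[of j] by linarith
  qed
  then have "(\<Sum>j\<in>(UNIV::'n set). - (3168 * s * (((norm (d j))\<^sup>2 + (norm v)\<^sup>2) / 2)) - 1152 * s * S)
    \<le> (\<Sum>j\<in>UNIV. weight2 k R k j x * (d j \<bullet> v) + 2 * weight1 k R j x * (d j \<bullet> d k))"
    by (rule sum_mono)
  moreover have "(\<Sum>j\<in>(UNIV::'n set). - (3168 * s * (((norm (d j))\<^sup>2 + (norm v)\<^sup>2) / 2)) - 1152 * s * S)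
    = - (1584 * s * S) - n * (1584 * s * (norm v)\<^sup>2) - n * (1152 * s * S)"
    by (simp add: sum_subtractf sum_negf n_def S_def sum_distrib_left[symmetric] sum.distrib sum_divide_distrib[symmetric]
        add_divide_distrib algebra_simps) (simp add: sum_distrib_right)
  moreover have "1584 * s * S \<le> n * (1584 * s * S)"
    using n mult_right_mono[OF n, of "1584 * s * S"] s S by simp
  \<comment> \<open>\<open>weight1 k R k\<close> is the cutoff plus
    \<open>x $ k * cutoff1 R k x\<close>; the first part is the main term, the second another shell
    error.\<close>
  moreover have "c * (cutoff R x * N) - n * (576 * (s * N)) \<le> c * weight1 k R k x * N"
  proof -
    have "\<bar>c * ((x $ k * cutoff1 R k x) * N)\<bar> \<le> 1 * ((576 * s) * N)"
      unfolding abs_mult[of c] abs_mult[of _ N] using c N weight_bounds(1)[OF R] s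
      by (intro mult_mono) (auto simp: s_def)
    moreover have "1 * (576 * (s * N)) \<le> n * (576 * (s * N))"
      using n s N by (intro mult_right_mono) auto
    ultimately show ?thesis
      unfolding weight1_def by (simp add: algebra_simps)
  qed
  moreover have "0 \<le> n * (s * S)" "0 \<le> n * (s * (norm v)\<^sup>2)" "0 \<le> n * (s * N)"
    using n s S N by auto
  ultimately show ?thesis
    unfolding s_def[symmetric] n_def[symmetric] S_def[symmetric]
    by (simp add: algebra_simps)
qed

text \<open>The error \<epsilon> is fixed before the function v: it depends only on the decay
  constants, p and the dimension. Applied to all time slices of a solution it is therefore uniform
  in time.\<close>

lemma virial_lower_bound:
  fixes C \<gamma> p :: real and k :: "'n::finite"
  assumes p: "p > 0" and C: "C > 0" and \<gamma>: "\<gamma> > 0"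
  obtains \<epsilon> where "(\<epsilon> \<longlongrightarrow> (0::real)) at_top"
    "\<And>R (v :: real^'n \<Rightarrow> complex) D H. R \<ge> 1 \<Longrightarrow> C2_with v D H \<Longrightarrow>
       (\<And>x. norm (v x) \<le> C * exp (- \<gamma> * norm x)) \<Longrightarrow>
       (\<And>x. norm (\<Sum>j\<in>UNIV. H j j x) \<le> C * exp (- \<gamma> * norm x)) \<Longrightarrow>
       p / (p + 2) * (\<integral>x. cutoff R x * norm (v x) powr (p + 2) \<partial>lborel) - \<epsilon> R \<le>
       (\<integral>x. (norm (v x) powr p *\<^sub>R v x - (\<Sum>j\<in>UNIV. H j j x)) \<bullet>
          (weight1 k R k x *\<^sub>R v x + (2 * weight k R x) *\<^sub>R D k x) \<partial>lborel)"
proof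
  define n where "n = real CARD('n)"
  define vol where "vol R = unit_ball_vol (real DIM(real^'n)) * (4 * R) ^ DIM(real^'n)" for R :: real
  \<comment> \<open>The bracket collects 3000 n + 1 from the Caccioppoli estimate, 1 from |v|^2 and
    C powr p from |v|^(p+2); the factor 4000 n is that of
    \<open>virial_integrand_bound\<close>.\<close>
  define K where "K = 4000 * n * (3000 * n + 2 + C powr p) * C\<^sup>2"
  define \<epsilon> where "\<epsilon> R = K * (exp (- \<gamma> * R) * vol R)" for R
  have n: "n \<ge> 1" by (simp add: n_def Suc_le_eq)
  have "((\<lambda>R. K * (unit_ball_vol (real DIM(real^'n)) * (exp (- \<gamma> * R) * (4 * R) ^ DIM(real^'n)))) \<longlongrightarrow>
     K * (unit_ball_vol (real DIM(real^'n)) * 0)) at_top"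
    by (intro tendsto_intros power_times_exp_tendsto_0 \<gamma>)
  then show "(\<epsilon> \<longlongrightarrow> 0) at_top"
    by (simp add: \<epsilon>_def[abs_def] vol_def mult_ac)
  fix R :: real and v :: "real^'n \<Rightarrow> complex" and D H
  assume R: "R \<ge> 1" and v: "C2_with v D H"
    and vb: "\<And>x. norm (v x) \<le> C * exp (- \<gamma> * norm x)"
    and Lb: "\<And>x. norm (\<Sum>j\<in>UNIV. H j j x) \<le> C * exp (- \<gamma> * norm x)"
  note vD = C2_withD[OF v]
  have R0: "R > 0" using R by simp
  \<comment> \<open>Every error density contains two decaying factors, and each is at most C
    exp(-\<gamma> R / 2) where the shell lives, namely for |x| at least R / 2.\<close>
  define E where "E = C\<^sup>2 * exp (- \<gamma> * R)"
  have E: "E \<ge> 0" by (simp add: E_def)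
  have prod: "a * b \<le> E" if "norm x \<ge> R / 2" "0 \<le> a" "0 \<le> b" "a \<le> C * exp (- \<gamma> * norm x)"
      "b \<le> C * exp (- \<gamma> * norm x)" for a b and x :: "real^'n"
  proof -
    have "C * exp (- \<gamma> * norm x) \<le> C * exp (- \<gamma> * (R / 2))"
      using that(1) C \<gamma> by simp
    then have "a \<le> C * exp (- \<gamma> * (R / 2))" "b \<le> C * exp (- \<gamma> * (R / 2))"
      using that(4,5) by (meson order_trans)+
    then have "a * b \<le> (C * exp (- \<gamma> * (R / 2))) * (C * exp (- \<gamma> * (R / 2)))"
      using that C by (intro mult_mono) auto
    also have "\<dots> = E"
      by (simp add: E_def power2_eq_square exp_add[symmetric] mult_ac)
    finally show ?thesis .
  qed
  have vC: "norm (v x) \<le> C" for x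
    by (rule order_trans[OF vb mult_left_le]) (use C \<gamma> in auto)
  have sh: "C2_with (shell R) (shell1 R) (shell2 R :: 'n \<Rightarrow> _)"
    by (rule C2_with_shell)
  have far: "shell R x = 0" "shell2 R i j x = 0" if "norm x > 4 * R" for x :: "real^'n" and i j
    using shell_eq(2,3)[OF R0, of x] that by simp_all
  have near: "shell R x = 0" "shell2 R i j x = 0" if "norm x < R / 2" for x :: "real^'n" and i j
    using shell_eq(2,3)[OF R0, of x] that by simp_all
  have vol: "integral\<^sup>L lborel f \<le> M * vol R"
    if "continuous_on UNIV f" "\<And>x. norm x > 4 * R \<Longrightarrow> f x = 0" "\<And>x. f x \<le> M" for f :: "real^'n \<Rightarrow> real" and M
    unfolding vol_def by (rule integral_le_ball[OF that]) (use R in auto)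
  let ?S = "\<lambda>x. \<Sum>j\<in>UNIV. (norm (D j x))\<^sup>2"
  let ?N = "\<lambda>x. norm (v x) powr (p + 2)"
  have cS: "continuous_on UNIV (\<lambda>x. shell R x * ?S x)"
    and cv: "continuous_on UNIV (\<lambda>x. shell R x * (norm (v x))\<^sup>2)"
    and cN: "continuous_on UNIV (\<lambda>x. shell R x * ?N x)"
    and cc: "continuous_on UNIV (\<lambda>x. cutoff R x * ?N x)"
    and cR: "continuous_on UNIV (\<lambda>x. (\<Sum>j\<in>UNIV. shell2 R j j x) / 2 * (norm (v x))\<^sup>2 - shell R x * ((\<Sum>j\<in>UNIV. H j j x) \<bullet> v x))"
    and cW: "continuous_on UNIV (\<lambda>x. (\<Sum>j\<in>UNIV. weight2 k R k j x * (D j x \<bullet> v x) + 2 * weight1 k R j x * (D j x \<bullet> D k x))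
         + p / (p + 2) * weight1 k R k x * ?N x)"
    using p by (auto intro!: continuous_intros vD(3-5) C2_withD(3-5)[OF C2_with_shell]
        C2_withD(3-5)[OF C2_with_cutoff] C2_withD(3-5)[OF C2_with_weight])
  \<comment> \<open>No decay of D is assumed, so the shell gradient is bounded through the identity.
    The 3000 n is half of the bound 6000 for n second derivatives of the shell.\<close>
  have IS: "(\<integral>x. shell R x * ?S x \<partial>lborel) \<le> (3000 * n + 1) * E * vol R"
  proof -
    have "(\<integral>x. shell R x * ?S x \<partial>lborel) =
      (\<integral>x. (\<Sum>j\<in>UNIV. shell2 R j j x) / 2 * (norm (v x))\<^sup>2 - shell R x * ((\<Sum>j\<in>UNIV. H j j x) \<bullet> v x) \<partial>lborel)"
      by (rule caccioppoli_identity[OF v sh far(1)])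
    also have "\<dots> \<le> (3000 * n + 1) * E * vol R"
    proof (rule vol[OF cR])
      fix x :: "real^'n"
      show "4 * R < norm x \<Longrightarrow> (\<Sum>j\<in>UNIV. shell2 R j j x) / 2 * (norm (v x))\<^sup>2 - shell R x * ((\<Sum>j\<in>UNIV. H j j x) \<bullet> v x) = 0"
        by (simp add: far)
      show "(\<Sum>j\<in>UNIV. shell2 R j j x) / 2 * (norm (v x))\<^sup>2 - shell R x * ((\<Sum>j\<in>UNIV. H j j x) \<bullet> v x) \<le> (3000 * n + 1) * E"
      proof (cases "norm x < R / 2")
        case True
        then show ?thesis using n E by (simp add: near)
      next
        case False
        have "(\<Sum>j\<in>UNIV. shell2 R j j x) \<le> (\<Sum>j\<in>(UNIV::'n set). 6000)"
          using shell2_bound[OF R, of _ _ x] by (intro sum_mono) (simp add: abs_le_iff)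
        then have "(\<Sum>j\<in>UNIV. shell2 R j j x) / 2 \<le> 3000 * n"
          by (simp add: n_def)
        then have "(\<Sum>j\<in>UNIV. shell2 R j j x) / 2 * (norm (v x))\<^sup>2 \<le> 3000 * n * (norm (v x))\<^sup>2"
          by (rule mult_right_mono) simp
        also have "\<dots> \<le> 3000 * n * E"
          using prod[of x "norm (v x)" "norm (v x)"] vb False n
          by (intro mult_left_mono) (auto simp: power2_eq_square)
        finally have 1: "(\<Sum>j\<in>UNIV. shell2 R j j x) / 2 * (norm (v x))\<^sup>2 \<le> 3000 * n * E" .
        have "\<bar>shell R x * ((\<Sum>j\<in>UNIV. H j j x) \<bullet> v x)\<bar> \<le> 1 * (norm (\<Sum>j\<in>UNIV. H j j x) * norm (v x))"
          unfolding abs_mult using shell_bounds[OF R0, of x] Cauchy_Schwarz_ineq2 by (intro mult_mono) auto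
        also have "\<dots> \<le> E"
          using prod[of x "norm (\<Sum>j\<in>UNIV. H j j x)" "norm (v x)"] vb Lb False by simp
        finally show ?thesis using 1 by (simp add: algebra_simps abs_le_iff)
      qed
    qed
    finally show ?thesis .
  qed
  have Iv: "(\<integral>x. shell R x * (norm (v x))\<^sup>2 \<partial>lborel) \<le> E * vol R"
  proof (rule vol[OF cv])
    fix x :: "real^'n"
    show "shell R x * (norm (v x))\<^sup>2 \<le> E"
    proof (cases "norm x < R / 2")
      case False
      have "shell R x * (norm (v x))\<^sup>2 \<le> 1 * (norm (v x))\<^sup>2"
        using shell_bounds[OF R0, of x] by (intro mult_right_mono) auto
      then show ?thesis
        using prod[of x "norm (v x)" "norm (v x)"] vb False by (simp add: power2_eq_square)
    qed (simp add: near E)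
  qed (simp add: far)
  have IN: "(\<integral>x. shell R x * ?N x \<partial>lborel) \<le> C powr p * E * vol R"
  proof (rule vol[OF cN])
    fix x :: "real^'n"
    show "shell R x * ?N x \<le> C powr p * E"
    proof (cases "norm x < R / 2")
      case False
      \<comment> \<open>Two of the p + 2 powers supply the exponential smallness; the other p are
        bounded by C powr p.\<close>
      have "shell R x * ?N x \<le> 1 * (norm (v x) powr p * (norm (v x))\<^sup>2)"
        using shell_bounds[OF R0, of x] by (intro mult_mono) (auto simp: powr_add)
      also have "1 * (norm (v x) powr p * (norm (v x))\<^sup>2) \<le> C powr p * E"
        using prod[of x "norm (v x)" "norm (v x)"] vb False vC[of x] p
        by (auto simp: power2_eq_square intro!: mult_mono powr_mono2)
      finally show ?thesis .
    qed (simp add: near E)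
  qed (simp add: far)
  let ?W = "\<lambda>x. (\<Sum>j\<in>UNIV. weight2 k R k j x * (D j x \<bullet> v x) + 2 * weight1 k R j x * (D j x \<bullet> D k x))
         + p / (p + 2) * weight1 k R k x * ?N x"
  have wz: "weight k R x = 0" "cutoff R x = 0" if "norm x > 2 * R" for x
    using cutoff_eq(2)[OF R0, of x] that by (auto simp: weight_def)
  have w1z: "weight1 k R j x = 0" if "norm x > 2 * R" for j x
    by (rule has_partial_zero_outside[OF C2_withD(1)[OF C2_with_weight] wz(1) that])
  have w2z: "weight2 k R i j x = 0" if "norm x > 2 * R" for i j x
    by (rule has_partial_zero_outside[OF C2_withD(2)[OF C2_with_weight] w1z that])
  have iW: "integrable lborel ?W"
    by (rule integrable_compact_support[OF cW, of "2 * R"]) (simp add: w1z w2z)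
  have ic: "integrable lborel (\<lambda>x. cutoff R x * ?N x)"
    by (rule integrable_compact_support[OF cc, of "2 * R"]) (simp add: wz)
  have iS: "integrable lborel (\<lambda>x. shell R x * ?S x)" "integrable lborel (\<lambda>x. shell R x * (norm (v x))\<^sup>2)"
    "integrable lborel (\<lambda>x. shell R x * ?N x)"
    using integrable_compact_support[OF cS, of "4 * R"] integrable_compact_support[OF cv, of "4 * R"]
      integrable_compact_support[OF cN, of "4 * R"] by (auto simp: far)
  have "(\<integral>x. p / (p + 2) * (cutoff R x * ?N x) - 4000 * n * (shell R x * ?S x + shell R x * (norm (v x))\<^sup>2 + shell R x * ?N x) \<partial>lborel)
      \<le> integral\<^sup>L lborel ?W"
    unfolding n_def using p by (intro Bochner_Integration.integral_mono iW virial_integrand_bound R)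
      (use ic iS in auto)
  also have "(\<integral>x. p / (p + 2) * (cutoff R x * ?N x) - 4000 * n * (shell R x * ?S x + shell R x * (norm (v x))\<^sup>2 + shell R x * ?N x) \<partial>lborel)
    = p / (p + 2) * (\<integral>x. cutoff R x * ?N x \<partial>lborel) - 4000 * n * ((\<integral>x. shell R x * ?S x \<partial>lborel)
       + (\<integral>x. shell R x * (norm (v x))\<^sup>2 \<partial>lborel) + (\<integral>x. shell R x * ?N x \<partial>lborel))"
    using ic iS by simp
  finally have *: "p / (p + 2) * (\<integral>x. cutoff R x * ?N x \<partial>lborel) - 4000 * n * ((\<integral>x. shell R x * ?S x \<partial>lborel)
       + (\<integral>x. shell R x * (norm (v x))\<^sup>2 \<partial>lborel) + (\<integral>x. shell R x * ?N x \<partial>lborel)) \<le> integral\<^sup>L lborel ?W" .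
  have "4000 * n * ((\<integral>x. shell R x * ?S x \<partial>lborel)
       + (\<integral>x. shell R x * (norm (v x))\<^sup>2 \<partial>lborel) + (\<integral>x. shell R x * ?N x \<partial>lborel))
     \<le> 4000 * n * ((3000 * n + 1) * E * vol R + E * vol R + C powr p * E * vol R)"
    using IS Iv IN n by (intro mult_left_mono add_mono) auto
  also have "\<dots> = \<epsilon> R"
    by (simp add: \<epsilon>_def K_def E_def algebra_simps)
  finally have "p / (p + 2) * (\<integral>x. cutoff R x * ?N x \<partial>lborel) - \<epsilon> R \<le> integral\<^sup>L lborel ?W"
    using * by linarith
  also have "integral\<^sup>L lborel ?W = (\<integral>x. (norm (v x) powr p *\<^sub>R v x - (\<Sum>j\<in>UNIV. H j j x)) \<bullet>
          (weight1 k R k x *\<^sub>R v x + (2 * weight k R x) *\<^sub>R D k x) \<partial>lborel)"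
    by (rule virial_identity[OF v C2_with_weight wz(1) p, symmetric])
  finally show "p / (p + 2) * (\<integral>x. cutoff R x * ?N x \<partial>lborel) - \<epsilon> R \<le>
       (\<integral>x. (norm (v x) powr p *\<^sub>R v x - (\<Sum>j\<in>UNIV. H j j x)) \<bullet>
          (weight1 k R k x *\<^sub>R v x + (2 * weight k R x) *\<^sub>R D k x) \<partial>lborel)" .
qed

section \<open>Differentiating the virial in time\<close>

text \<open>
  Integrating by parts before differentiating in time removes the spatial derivative from the
  increment \<open>u' - u\<close>; this is needed because no time derivative of the gradient is available.
\<close>
lemma integral_virial_increment:
  fixes a A :: "real^'n::finite \<Rightarrow> real" and u u' D D' :: "real^'n \<Rightarrow> complex"
  assumes a: "has_partial k a A" "continuous_on UNIV a" "continuous_on UNIV A" "\<And>x. norm x > r \<Longrightarrow> a x = 0"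
    and u: "has_partial k u D" "continuous_on UNIV u" "continuous_on UNIV D"
    and u': "has_partial k u' D'" "continuous_on UNIV u'" "continuous_on UNIV D'"
  shows "(\<integral>x. a x * (D' x \<bullet> (\<i> * u' x)) \<partial>lborel) - (\<integral>x. a x * (D x \<bullet> (\<i> * u x)) \<partial>lborel)
    = (\<integral>x. (\<i> * (u' x - u x)) \<bullet> (A x *\<^sub>R u' x + a x *\<^sub>R D' x + a x *\<^sub>R D x) \<partial>lborel)"
proof -
  have A0: "A x = 0" if "norm x > r" for x
    using has_partial_zero_outside[OF a(1,4) that] .
  define f where "f x = a x * ((u' x - u x) \<bullet> (\<i> * u' x))" for x
  define g where "g x = a x * ((u' x - u x) \<bullet> (\<i> * D' x) + (D' x - D x) \<bullet> (\<i> * u' x))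
      + A x * ((u' x - u x) \<bullet> (\<i> * u' x))" for x
  have p: "has_partial k f g"
    unfolding f_def[abs_def] g_def[abs_def]
    by (intro has_partial_mult a has_partial_inner has_partial_diff u u' has_partial_linear[OF bounded_linear_mult_right])
  have c: "continuous_on UNIV f" "continuous_on UNIV g"
    "continuous_on UNIV (\<lambda>x. a x * (D' x \<bullet> (\<i> * u' x)))" "continuous_on UNIV (\<lambda>x. a x * (D x \<bullet> (\<i> * u x)))"
    "continuous_on UNIV (\<lambda>x. (\<i> * (u' x - u x)) \<bullet> (A x *\<^sub>R u' x + a x *\<^sub>R D' x + a x *\<^sub>R D x))"
    unfolding f_def[abs_def] g_def[abs_def] by (intro continuous_intros a u u')+
  have z: "norm x > r \<Longrightarrow> f x = 0" "norm x > r \<Longrightarrow> g x = 0" for x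
    using a(4) A0 by (auto simp: f_def g_def)
  have "integral\<^sup>L lborel g = 0"
    by (rule integral_partial_eq_0[OF p c(1,2) z(1)])
  moreover have "integrable lborel g"
    by (rule integrable_compact_support[OF c(2) z(2)])
  ultimately have "integral\<^sup>L lborel (\<lambda>x. a x * (D' x \<bullet> (\<i> * u' x)) - a x * (D x \<bullet> (\<i> * u x)))
    = (\<integral>x. (\<i> * (u' x - u x)) \<bullet> (A x *\<^sub>R u' x + a x *\<^sub>R D' x + a x *\<^sub>R D x) \<partial>lborel)"
  proof (intro integral_eq_up_to_null[where h = g])
    show "integrable lborel (\<lambda>x. (\<i> * (u' x - u x)) \<bullet> (A x *\<^sub>R u' x + a x *\<^sub>R D' x + a x *\<^sub>R D x))"
      by (rule integrable_compact_support[OF c(5), of r]) (use a(4) A0 in auto)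
    fix x
    show "a x * (D' x \<bullet> (\<i> * u' x)) - a x * (D x \<bullet> (\<i> * u x)) =
      (\<i> * (u' x - u x)) \<bullet> (A x *\<^sub>R u' x + a x *\<^sub>R D' x + a x *\<^sub>R D x) + g x"
      unfolding g_def by (simp add: inner_complex_def algebra_simps)
  qed auto
  moreover have "integrable lborel (\<lambda>x. a x * (D' x \<bullet> (\<i> * u' x)))" "integrable lborel (\<lambda>x. a x * (D x \<bullet> (\<i> * u x)))"
    using integrable_compact_support[OF c(3), of r] integrable_compact_support[OF c(4), of r] a(4) by auto
  ultimately show ?thesis by simp
qed

lemma virial_has_derivative:
  fixes a A :: "real^'n::finite \<Rightarrow> real" and u D T :: "real \<Rightarrow> real^'n \<Rightarrow> complex"
  assumes a: "has_partial k a A" "continuous_on UNIV a" "continuous_on UNIV A" "\<And>x. norm x > r \<Longrightarrow> a x = 0"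
    and u: "\<And>t. has_partial k (u t) (D t)" "\<And>t. continuous_on UNIV (u t)" "\<And>t. continuous_on UNIV (D t)"
    and T: "\<And>t x. ((\<lambda>s. u s x) has_vector_derivative T t x) (at t)" "\<And>t. continuous_on UNIV (T t)"
    and bounds: "\<And>t x. norm (u t x) \<le> C" "\<And>t x. norm (T t x) \<le> C'" "\<And>t x. norm (D t x) \<le> G x" "continuous_on UNIV G"
    and cont: "\<And>x. isCont (\<lambda>s. D s x) t"
  shows "((\<lambda>t. \<integral>x. a x * (D t x \<bullet> (\<i> * u t x)) \<partial>lborel) has_real_derivative
     (\<integral>x. (\<i> * T t x) \<bullet> (A x *\<^sub>R u t x + (2 * a x) *\<^sub>R D t x) \<partial>lborel)) (at t)"
proof -
  have A0: "A x = 0" if "norm x > r" for x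
    using has_partial_zero_outside[OF a(1,4) that] .
  define F where "F h x = (\<i> * ((u (t + h) x - u t x) /\<^sub>R h)) \<bullet>
      (A x *\<^sub>R u (t + h) x + a x *\<^sub>R D (t + h) x + a x *\<^sub>R D t x)" for h x
  obtain Ba BA BG where B: "Ba \<ge> 0" "BA \<ge> 0" "BG \<ge> 0" "\<And>x. norm x \<le> r \<Longrightarrow> \<bar>a x\<bar> \<le> Ba"
    "\<And>x. norm x \<le> r \<Longrightarrow> \<bar>A x\<bar> \<le> BA" "\<And>x. norm x \<le> r \<Longrightarrow> \<bar>G x\<bar> \<le> BG"
    using continuous_bound_cball[OF a(2), of r] continuous_bound_cball[OF a(3), of r]
      continuous_bound_cball[OF bounds(4), of r] by metis
  have C: "C \<ge> 0" "C' \<ge> 0"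
    using order_trans[OF norm_ge_zero bounds(1)] order_trans[OF norm_ge_zero bounds(2)] by auto
  have "((\<lambda>h. integral\<^sup>L lborel (F h)) \<longlongrightarrow>
     (\<integral>x. (\<i> * T t x) \<bullet> (A x *\<^sub>R u t x + a x *\<^sub>R D t x + a x *\<^sub>R D t x) \<partial>lborel)) (at 0)"
  proof (rule integral_tendsto_at_0[where r = r and B = "C' * (BA * C + Ba * BG + Ba * BG)"])
    show "F h \<in> borel_measurable borel" for h
      unfolding F_def[abs_def]
      by (intro borel_measurable_continuous_onI continuous_intros a u)
    show "(\<lambda>x. (\<i> * T t x) \<bullet> (A x *\<^sub>R u t x + a x *\<^sub>R D t x + a x *\<^sub>R D t x)) \<in> borel_measurable borel"
      by (intro borel_measurable_continuous_onI continuous_intros a u T)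
    show "F h x = 0" if "norm x > r" for h x
      using that a(4) A0 by (simp add: F_def)
    show "\<bar>F h x\<bar> \<le> C' * (BA * C + Ba * BG + Ba * BG)" if h: "h \<noteq> 0" for h x
    proof (cases "norm x > r")
      case True
      then show ?thesis using a(4) A0 B C by (simp add: F_def)
    next
      case False
      then have x: "norm x \<le> r" by simp
      have "norm (u (t + h) x - u t x) \<le> C' * \<bar>t + h - t\<bar>"
        using T(1) bounds(2) by (intro vector_derivative_bound) auto
      then have 1: "norm (\<i> * ((u (t + h) x - u t x) /\<^sub>R h)) \<le> C'"
        using h by (simp add: norm_mult divide_simps)
      have D: "norm (D s x) \<le> BG" for s
        using bounds(3)[of s x] B(6)[OF x] by linarith
      have "norm (A x *\<^sub>R u (t + h) x + a x *\<^sub>R D (t + h) x + a x *\<^sub>R D t x) \<le> BA * C + Ba * BG + Ba * BG"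
        using B D x bounds(1) by (intro norm_triangle_le add_mono) (auto intro!: mult_mono)
      then have "norm (\<i> * ((u (t + h) x - u t x) /\<^sub>R h)) * norm (A x *\<^sub>R u (t + h) x + a x *\<^sub>R D (t + h) x + a x *\<^sub>R D t x)
        \<le> C' * (BA * C + Ba * BG + Ba * BG)"
        using 1 C by (intro mult_mono) auto
      then show ?thesis
        unfolding F_def using Cauchy_Schwarz_ineq2 order_trans by blast
    qed
    show "((\<lambda>h. F h x) \<longlongrightarrow> (\<i> * T t x) \<bullet> (A x *\<^sub>R u t x + a x *\<^sub>R D t x + a x *\<^sub>R D t x)) (at 0)" for x
    proof -
      have "((\<lambda>h. u (t + h) x) \<longlongrightarrow> u t x) (at 0)"
        using has_vector_derivative_continuous[OF T(1)] by (simp add: isCont_iff)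
      moreover have "((\<lambda>h. D (t + h) x) \<longlongrightarrow> D t x) (at 0)"
        using cont[of x] by (simp add: isCont_iff)
      moreover have "((\<lambda>h. (u (t + h) x - u t x) /\<^sub>R h) \<longlongrightarrow> T t x) (at 0)"
        by (rule has_vector_derivative_quotient[OF T(1)])
      ultimately show ?thesis
        unfolding F_def by (intro tendsto_intros)
    qed
  qed
  moreover have "integral\<^sup>L lborel (F h) =
     ((\<integral>x. a x * (D (t + h) x \<bullet> (\<i> * u (t + h) x)) \<partial>lborel) - (\<integral>x. a x * (D t x \<bullet> (\<i> * u t x)) \<partial>lborel)) / h" for h
  proof -
    have "F h = (\<lambda>x. (\<i> * (u (t + h) x - u t x)) \<bullet>
      (A x *\<^sub>R u (t + h) x + a x *\<^sub>R D (t + h) x + a x *\<^sub>R D t x) / h)"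
      by (simp add: F_def fun_eq_iff divide_inverse mult.commute)
    moreover have "(\<integral>x. a x * (D (t + h) x \<bullet> (\<i> * u (t + h) x)) \<partial>lborel) - (\<integral>x. a x * (D t x \<bullet> (\<i> * u t x)) \<partial>lborel)
      = (\<integral>x. (\<i> * (u (t + h) x - u t x)) \<bullet> (A x *\<^sub>R u (t + h) x + a x *\<^sub>R D (t + h) x + a x *\<^sub>R D t x) \<partial>lborel)"
      by (rule integral_virial_increment[OF a u u])
    ultimately show ?thesis
      by simp
  qed
  ultimately show ?thesis
    by (simp add: DERIV_def scaleR_2[symmetric] add.assoc flip: scaleR_add_left)
qed

lemma isCont_partial_of_bounded_second:
  fixes f :: "real \<Rightarrow> real^'n::finite \<Rightarrow> 'b::real_normed_vector"
  assumes f1: "\<And>s. has_partial k (f s) (f1 s)" and f2: "\<And>s. has_partial k (f1 s) (f2 s)"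
    and B: "\<And>s x. norm (f2 s x) \<le> B" and cont: "\<And>x. isCont (\<lambda>s. f s x) t"
  shows "isCont (\<lambda>s. f1 s x) t"
proof -
  define e :: "real^'n" where "e = axis k 1"
  have B0: "B \<ge> 0" using order_trans[OF norm_ge_zero B] .
  have taylor: "norm (f s (x + r *\<^sub>R e) - f s x - r *\<^sub>R f1 s x) \<le> B * r * r" if "r > 0" for s r
  proof -
    have "norm ((f s (x + r *\<^sub>R e) - r *\<^sub>R f1 s x) - (f s (x + 0 *\<^sub>R e) - 0 *\<^sub>R f1 s x)) \<le> (B * r) * \<bar>r - 0\<bar>"
    proof (rule vector_derivative_bound)
      fix q assume "q \<in> closed_segment 0 r"
      then have q: "0 \<le> q" "q \<le> r" using that by (auto simp: closed_segment_eq_real_ivl split: if_splits)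
      show "((\<lambda>r. f s (x + r *\<^sub>R e) - r *\<^sub>R f1 s x) has_vector_derivative
          f1 s (x + q *\<^sub>R e) - 1 *\<^sub>R f1 s x) (at q)"
        unfolding e_def
        by (intro has_vector_derivative_diff has_partial_line[OF f1] bounded_linear.has_vector_derivative[OF bounded_linear_scaleR_left] has_vector_derivative_id)
      have "norm (f1 s (x + q *\<^sub>R e) - f1 s (x + 0 *\<^sub>R e)) \<le> B * \<bar>q - 0\<bar>"
        unfolding e_def by (rule vector_derivative_bound[OF has_partial_line[OF f2] B])
      then show "norm (f1 s (x + q *\<^sub>R e) - 1 *\<^sub>R f1 s x) \<le> B * r"
        using q B0 mult_left_mono[of q r B] by simp
    qed
    then show ?thesis using that by (simp add: algebra_simps)
  qed
  show ?thesis
    unfolding isCont_def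
  proof (rule tendstoI)
    fix \<epsilon> :: real assume \<epsilon>: "\<epsilon> > 0"
    define r where "r = \<epsilon> / (4 * (B + 1))"
    have r: "r > 0" "2 * B * r < \<epsilon> / 2 + \<epsilon> / 4"
      using \<epsilon> B0 by (auto simp: r_def field_simps intro!: add_pos_nonneg)
    have ev: "\<forall>\<^sub>F s in at t. dist (f s y) (f t y) < r * \<epsilon> / 8" for y
      using cont[of y] r \<epsilon> by (intro tendstoD) (auto simp: isCont_def)
    show "\<forall>\<^sub>F s in at t. dist (f1 s x) (f1 t x) < \<epsilon>"
      using ev[of x] ev[of "x + r *\<^sub>R e"]
    proof eventually_elim
      case (elim s)
      have "r *\<^sub>R (f1 s x - f1 t x) = (f s (x + r *\<^sub>R e) - f t (x + r *\<^sub>R e)) - (f s x - f t x)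
         - (f s (x + r *\<^sub>R e) - f s x - r *\<^sub>R f1 s x) + (f t (x + r *\<^sub>R e) - f t x - r *\<^sub>R f1 t x)"
        by (simp add: algebra_simps)
      also have "norm \<dots> \<le> norm (f s (x + r *\<^sub>R e) - f t (x + r *\<^sub>R e)) + norm (f s x - f t x)
         + norm (f s (x + r *\<^sub>R e) - f s x - r *\<^sub>R f1 s x) + norm (f t (x + r *\<^sub>R e) - f t x - r *\<^sub>R f1 t x)"
        by (intro norm_triangle_le norm_triangle_le_diff add_mono order_refl)
      also have "\<dots> < r * \<epsilon> / 8 + r * \<epsilon> / 8 + B * r * r + B * r * r"
        using elim[unfolded dist_norm] taylor[OF r(1), of s] taylor[OF r(1), of t] by linarith
      also have "\<dots> = r * (\<epsilon> / 4 + 2 * B * r)"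
        by (simp add: algebra_simps)
      finally have "r * norm (f1 s x - f1 t x) < r * (\<epsilon> / 4 + 2 * B * r)"
        using r(1) by simp
      then have "norm (f1 s x - f1 t x) < \<epsilon> / 4 + 2 * B * r"
        using r(1) by simp
      then show ?case using r(2) by (simp add: dist_norm)
    qed
  qed
qed

lemma integral_pos_continuous:
  fixes f :: "'a::euclidean_space \<Rightarrow> real"
  assumes f: "continuous_on UNIV f" "\<And>x. norm x > r \<Longrightarrow> f x = 0" "\<And>x. f x \<ge> 0" and x0: "f x0 > 0"
  shows "integral\<^sup>L lborel f > 0"
proof -
  have "isCont f x0" using f(1) by (simp add: continuous_on_eq_continuous_at)
  then have "\<exists>d>0. \<forall>y. dist y x0 < d \<longrightarrow> dist (f y) (f x0) < f x0 / 2"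
    unfolding continuous_at_eps_delta using half_gt_zero[OF x0] by blast
  then obtain d where d: "d > 0" "\<And>y. dist y x0 < d \<Longrightarrow> dist (f y) (f x0) < f x0 / 2" by auto
  have i: "integrable lborel f" using f(1,2) by (rule integrable_compact_support)
  have fin: "emeasure lborel (ball x0 d) < \<infinity>"
    by (rule emeasure_bounded_finite) simp
  have "0 < measure lborel (ball x0 d) * (f x0 / 2)"
    using content_ball_pos[OF d(1), of x0] x0 by simp
  also have "\<dots> = (\<integral>x. indicator (ball x0 d) x * (f x0 / 2) \<partial>lborel)"
    by simp
  also have "\<dots> \<le> integral\<^sup>L lborel f"
  proof (rule Bochner_Integration.integral_mono[OF _ i])
    show "integrable lborel (\<lambda>x. indicator (ball x0 d) x * (f x0 / 2))"
      using fin by (intro integrable_mult_left integrable_real_indicator) auto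
    show "indicator (ball x0 d) x * (f x0 / 2) \<le> f x" for x
    proof (cases "x \<in> ball x0 d")
      case True
      then have "\<bar>f x - f x0\<bar> < f x0 / 2"
        using d(2)[of x] unfolding mem_ball dist_commute[of x0 x] dist_real_def by simp
      then have "f x0 / 2 \<le> f x" by linarith
      then show ?thesis using True by simp
    qed (simp add: f(3))
  qed
  finally show ?thesis .
qed

section \<open>Periodic decaying solutions vanish\<close>

lemma periodic_decaying_solution_eq_0:
  fixes u T :: "real \<Rightarrow> real^'n::finite \<Rightarrow> complex" and k :: 'n
  assumes p: "p > 0" and C: "C > 0" and \<gamma>: "\<gamma> > 0" and P: "P > 0"
    and u: "\<And>t. C2_with (u t) (D t) (H t)"
    and T: "\<And>t x. ((\<lambda>s. u s x) has_vector_derivative T t x) (at t)"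
    and eq: "\<And>t x. \<i> * T t x + (\<Sum>j\<in>UNIV. H t j j x) = norm (u t x) powr p *\<^sub>R u t x"
    and ub: "\<And>t x. norm (u t x) \<le> C * exp (- \<gamma> * norm x)"
    and Lb: "\<And>t x. norm (\<Sum>j\<in>UNIV. H t j j x) \<le> C * exp (- \<gamma> * norm x)"
    and G: "\<And>t x. norm (D t k x) \<le> G x" "continuous_on UNIV G"
    and Dcont: "\<And>t x. isCont (\<lambda>s. D s k x) t"
    and periodic: "\<And>t x. u (t + P) x = u t x"
  shows "u t0 x0 = 0"
proof (rule ccontr)
  assume nz: "u t0 x0 \<noteq> 0"
  note uD = C2_withD[OF u]
  have C_bound: "C * exp (- \<gamma> * norm x) \<le> C" for x :: "real^'n"
    using C \<gamma> by (intro mult_left_le) auto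
  have uC: "norm (u t x) \<le> C" and LC: "norm (\<Sum>j\<in>UNIV. H t j j x) \<le> C" for t x
    using order_trans[OF ub C_bound] order_trans[OF Lb C_bound] by auto
  have iT: "\<i> * T t x = norm (u t x) powr p *\<^sub>R u t x - (\<Sum>j\<in>UNIV. H t j j x)" for t x
    using eq[of t x] by (simp add: algebra_simps)
  have T_eq: "T t x = - \<i> * (norm (u t x) powr p *\<^sub>R u t x - (\<Sum>j\<in>UNIV. H t j j x))" for t x
    unfolding iT[symmetric] by simp
  have Tc: "continuous_on UNIV (T t)" for t
    unfolding T_eq[abs_def] using p by (intro continuous_intros uD) auto
  have TC: "norm (T t x) \<le> C powr p * C + C" for t x
  proof -
    have "norm (T t x) = norm (norm (u t x) powr p *\<^sub>R u t x - (\<Sum>j\<in>UNIV. H t j j x))"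
      unfolding T_eq norm_mult by simp
    also have "\<dots> \<le> norm (norm (u t x) powr p *\<^sub>R u t x) + norm (\<Sum>j\<in>UNIV. H t j j x)"
      by (rule norm_triangle_ineq4)
    also have "\<dots> \<le> C powr p * C + C"
      using uC[of t x] LC[of t x] p C by (intro add_mono) (auto intro!: mult_mono powr_mono2)
    finally show ?thesis .
  qed
  define R0 where "R0 = 1 + norm x0"
  have R0: "R0 \<ge> 1" "R0 > 0" by (simp_all add: R0_def add_pos_nonneg)
  define b where "b t = (\<integral>x. cutoff R0 x * norm (u t x) powr (p + 2) \<partial>lborel)" for t
  have cont: "continuous_on UNIV (\<lambda>x. cutoff R x * norm (u t x) powr (p + 2))" for R t
    using p by (intro continuous_intros uD C2_withD(3)[OF C2_with_cutoff]) auto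
  have far: "cutoff R x * norm (u t x) powr (p + 2) = 0" if "norm x > 2 * R" "R > 0" for R t x
    using that cutoff_eq(2)[of R x] by simp
  have b_nonneg: "b t \<ge> 0" for t
    unfolding b_def by (intro Bochner_Integration.integral_nonneg) (auto simp: cutoff_bounds)
  have b0: "b t0 > 0"
    unfolding b_def
    by (rule integral_pos_continuous[where ?x0.0 = x0, OF cont far[OF _ R0(2)]])
       (use nz R0 in \<open>auto simp: cutoff_bounds cutoff_eq(1) R0_def\<close>)
  have "isCont b t0"
    unfolding isCont_iff b_def
  proof (rule integral_tendsto_at_0[where r = "2 * R0" and B = "C powr (p + 2)"])
    show "(\<lambda>x. cutoff R0 x * norm (u (t0 + h) x) powr (p + 2)) \<in> borel_measurable borel"
      "(\<lambda>x. cutoff R0 x * norm (u t0 x) powr (p + 2)) \<in> borel_measurable borel" for h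
      using cont by (auto intro: borel_measurable_continuous_onI)
    show "\<bar>cutoff R0 x * norm (u (t0 + h) x) powr (p + 2)\<bar> \<le> C powr (p + 2)" for h x
    proof -
      have "cutoff R0 x * norm (u (t0 + h) x) powr (p + 2) \<le> 1 * C powr (p + 2)"
        using uC p cutoff_bounds by (intro mult_mono powr_mono2) auto
      then show ?thesis using cutoff_bounds(1)[of R0 x] by (simp add: abs_mult)
    qed
    show "((\<lambda>h. cutoff R0 x * norm (u (t0 + h) x) powr (p + 2)) \<longlongrightarrow> cutoff R0 x * norm (u t0 x) powr (p + 2)) (at 0)" for x
    proof -
      have "((\<lambda>h. u (t0 + h) x) \<longlongrightarrow> u t0 x) (at 0)"
        using has_vector_derivative_continuous[OF T] by (simp add: isCont_iff)
      then show ?thesis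
        using p by (intro tendsto_intros tendsto_powr') auto
    qed
  qed (use far R0 in auto)
  then have "\<exists>d>0. \<forall>t. dist t t0 < d \<longrightarrow> dist (b t) (b t0) < b t0 / 2"
    unfolding continuous_at_eps_delta using half_gt_zero[OF b0] by blast
  then obtain d where d: "d > 0" "\<And>t. dist t t0 < d \<Longrightarrow> dist (b t) (b t0) < b t0 / 2" by auto
  define \<tau> where "\<tau> = min (d / 2) (P / 2)"
  have \<tau>: "\<tau> > 0" "\<tau> < d" "\<tau> < P" using d P by (auto simp: \<tau>_def)
  have b_lower: "b t \<ge> b t0 / 2" if "t0 \<le> t" "t \<le> t0 + \<tau>" for t
  proof -
    have "\<bar>b t - b t0\<bar> < b t0 / 2"
      using d(2)[of t] that \<tau> by (simp add: dist_real_def)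
    then show ?thesis by linarith
  qed
  define c where "c = p / (p + 2)"
  have c: "c > 0" using p by (simp add: c_def)
  obtain \<epsilon> where \<epsilon>0: "(\<epsilon> \<longlongrightarrow> (0::real)) at_top" and \<epsilon>:
    "\<And>R (v :: real^'n \<Rightarrow> complex) D H. R \<ge> 1 \<Longrightarrow> C2_with v D H \<Longrightarrow>
       (\<And>x. norm (v x) \<le> C * exp (- \<gamma> * norm x)) \<Longrightarrow>
       (\<And>x. norm (\<Sum>j\<in>UNIV. H j j x) \<le> C * exp (- \<gamma> * norm x)) \<Longrightarrow>
       p / (p + 2) * (\<integral>x. cutoff R x * norm (v x) powr (p + 2) \<partial>lborel) - \<epsilon> R \<le>
       (\<integral>x. (norm (v x) powr p *\<^sub>R v x - (\<Sum>j\<in>UNIV. H j j x)) \<bullet>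
          (weight1 k R k x *\<^sub>R v x + (2 * weight k R x) *\<^sub>R D k x) \<partial>lborel)"
    using virial_lower_bound[OF p C \<gamma>, of k] by blast
  have "0 < \<tau> * (c * (b t0 / 2)) / P" using \<tau> c b0 P by simp
  then have "\<forall>\<^sub>F R in at_top. \<epsilon> R < \<tau> * (c * (b t0 / 2)) / P \<and> R \<ge> 2 * R0"
    using order_tendstoD(2)[OF \<epsilon>0] eventually_ge_at_top by (intro eventually_conj) auto
  then obtain R where R: "\<epsilon> R < \<tau> * (c * (b t0 / 2)) / P" "R \<ge> 2 * R0"
    by (auto simp: eventually_at_top_linorder)
  have R1: "R \<ge> 1" "R > 0" using R R0 by auto
  define M where "M t = (\<integral>x. weight k R x * (D t k x \<bullet> (\<i> * u t x)) \<partial>lborel)" for t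
  define V where "V t = (\<integral>x. (\<i> * T t x) \<bullet> (weight1 k R k x *\<^sub>R u t x + (2 * weight k R x) *\<^sub>R D t k x) \<partial>lborel)" for t
  have wz: "weight k R x = 0" if "norm x > 2 * R" for x
    using cutoff_eq(2)[OF R1(2), of x] that by (auto simp: weight_def)
  have deriv: "(M has_real_derivative V t) (at t)" for t
    unfolding M_def[abs_def] V_def
    by (rule virial_has_derivative[OF C2_withD(1,3,4)[OF C2_with_weight] wz uD(1) uD(3) uD(4) T Tc uC TC G Dcont])
  have V_lower: "c * b t - \<epsilon> R \<le> V t" for t
  proof -
    have "b t \<le> (\<integral>x. cutoff R x * norm (u t x) powr (p + 2) \<partial>lborel)"
      unfolding b_def
    proof (rule Bochner_Integration.integral_mono)
      show "integrable lborel (\<lambda>x. cutoff R0 x * norm (u t x) powr (p + 2))"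
        using cont far[OF _ R0(2)] by (rule integrable_compact_support)
      show "integrable lborel (\<lambda>x. cutoff R x * norm (u t x) powr (p + 2))"
        using cont far[OF _ R1(2)] by (rule integrable_compact_support)
      show "cutoff R0 x * norm (u t x) powr (p + 2) \<le> cutoff R x * norm (u t x) powr (p + 2)" for x
      proof (rule mult_right_mono)
        show "cutoff R0 x \<le> cutoff R x"
          using R(2) R1 R0 cutoff_eq(1)[of R x] cutoff_eq(2)[of R0 x] cutoff_bounds[of R0 x] cutoff_bounds[of R x]
          by (cases "norm x \<le> R") auto
      qed simp
    qed
    then have "c * b t \<le> c * (\<integral>x. cutoff R x * norm (u t x) powr (p + 2) \<partial>lborel)"
      using c by simp
    also have "\<dots> - \<epsilon> R \<le> V t"
      unfolding V_def iT c_def by (rule \<epsilon>[OF R1(1) u ub Lb])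
    finally show ?thesis by simp
  qed
  have "D (t0 + P) k = D t0 k"
  proof (rule has_partial_unique[OF uD(1)])
    have "u (t0 + P) = u t0" by (rule ext) (rule periodic)
    then show "has_partial k (u (t0 + P)) (D t0 k)" by (simp add: uD(1))
  qed
  then have "M (t0 + P) = M t0"
    by (simp add: M_def periodic)
  moreover obtain s1 where s1: "t0 < s1" "s1 < t0 + \<tau>" "M (t0 + \<tau>) - M t0 = (t0 + \<tau> - t0) * V s1"
    using MVT2[of t0 "t0 + \<tau>" M V] \<tau> deriv by auto
  moreover obtain s2 where s2: "M (t0 + P) - M (t0 + \<tau>) = (t0 + P - (t0 + \<tau>)) * V s2"
    using MVT2[of "t0 + \<tau>" "t0 + P" M V] \<tau> deriv by auto
  ultimately have "0 = \<tau> * V s1 + (P - \<tau>) * V s2"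
    by simp
  moreover have "\<tau> * (c * (b t0 / 2) - \<epsilon> R) \<le> \<tau> * V s1"
  proof (rule mult_left_mono)
    have "c * (b t0 / 2) \<le> c * b s1" using b_lower[of s1] s1 c by simp
    then show "c * (b t0 / 2) - \<epsilon> R \<le> V s1" using V_lower[of s1] by linarith
  qed (use \<tau> in simp)
  moreover have "(P - \<tau>) * (- \<epsilon> R) \<le> (P - \<tau>) * V s2"
  proof (rule mult_left_mono)
    show "- \<epsilon> R \<le> V s2" using V_lower[of s2] b_nonneg[of s2] c mult_nonneg_nonneg[of c "b s2"] by linarith
  qed (use \<tau> in simp)
  ultimately have "\<tau> * (c * (b t0 / 2)) \<le> P * \<epsilon> R"
    by (simp add: algebra_simps)
  then show False
    using R(1) P by (simp add: field_simps)
qed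

section \<open>Breathers\<close>

lemma C2_with_unique:
  assumes "C2_with f D H" "C2_with f D' H'"
  shows "D i = D' i" "H i j = H' i j"
proof -
  show D: "D i = D' i" for i
    by (rule has_partial_unique[OF C2_withD(1)[OF assms(1)] C2_withD(1)[OF assms(2)]])
  show "H i j = H' i j"
    using C2_withD(2)[OF assms(1), of j i] C2_withD(2)[OF assms(2), of j i]
    unfolding D by (rule has_partial_unique)
qed

lemma C2_with_linear:
  assumes "bounded_linear h" "C2_with f D H"
  shows "C2_with (\<lambda>x. h (f x)) (\<lambda>i x. h (D i x)) (\<lambda>i j x. h (H i j x))"
  unfolding C2_with_def
  by (intro conjI allI has_partial_linear[OF assms(1)] bounded_linear.continuous_on[OF assms(1)]
      C2_withD[OF assms(2)])

lemma C2_with_add: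
  assumes "C2_with f D H" "C2_with g D' H'"
  shows "C2_with (\<lambda>x. f x + g x) (\<lambda>i x. D i x + D' i x) (\<lambda>i j x. H i j x + H' i j x)"
  unfolding C2_with_def
  by (intro conjI allI has_partial_add continuous_on_add C2_withD[OF assms(1)] C2_withD[OF assms(2)])

lemma C2_with_scale_arg:
  assumes "C2_with f D H"
  shows "C2_with (\<lambda>x. f (c *\<^sub>R x)) (\<lambda>i x. c *\<^sub>R D i (c *\<^sub>R x)) (\<lambda>i j x. c *\<^sub>R c *\<^sub>R H i j (c *\<^sub>R x))"
proof -
  note d = C2_withD[OF assms]
  have c: "continuous_on UNIV (\<lambda>x. g (c *\<^sub>R x))" if "continuous_on UNIV g" for g :: "real^'a \<Rightarrow> 'b"
    by (rule continuous_on_compose2[OF that]) (auto intro!: continuous_intros)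
  show ?thesis
    unfolding C2_with_def
    by (intro conjI allI has_partial_scale_arg has_partial_linear[OF bounded_linear_scaleR_right]
        continuous_on_scaleR continuous_on_const c d)
qed

theorem theorem2p1:
  fixes p :: real
  assumes "0 < p" and "ereal p < energy_critical_power CARD('n::finite)"
  shows "\<not> (\<exists>u :: real \<Rightarrow> real^'n \<Rightarrow> complex. breather p u)"
proof
  assume "\<exists>u :: real \<Rightarrow> real^'n \<Rightarrow> complex. breather p u"
  then obtain u :: "real \<Rightarrow> real^'n \<Rightarrow> complex" and Q z \<omega> C \<gamma> where
    sol: "defocusing_NLS_solution p u" and nonzero: "\<exists>t x. u t x \<noteq> 0" and
    Q: "ground_state p Q" and pos: "\<omega> > 0" "C > 0" "\<gamma> > 0" and
    u_eq: "\<And>t x. u t x = exp (\<i> * complex_of_real (\<omega> * t)) * (complex_of_real (scaled_state p Q \<omega> x) + z t x)" and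
    per: "\<And>t x. u (t + 2 * pi / \<omega>) x = u t x" and
    smooth: "\<And>t. smooth (z t)" and
    dec: "\<And>\<alpha> t x. length \<alpha> \<le> 2 \<Longrightarrow> cmod (multi_deriv \<alpha> (z t) x) \<le> C * exp (- \<gamma> * norm x)"
    unfolding breather_def by blast
  obtain k :: 'n where True by simp
  define \<kappa> \<rho> where "\<kappa> = \<omega> powr (1 / p)" and "\<rho> = sqrt \<omega>"
  have \<kappa>\<rho>: "\<kappa> > 0" "\<rho> > 0" "\<rho> * \<rho> = \<omega>" using pos by (simp_all add: \<kappa>_def \<rho>_def)
  obtain C1 \<gamma>1 where C1: "C1 > 0" "\<gamma>1 > 0" and Q_decay: "\<And>x. \<bar>Q x\<bar> \<le> C1 * exp (- \<gamma>1 * norm x)"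
    and Q_pos: "\<And>x. 0 < Q x" and Q2: "Ck 2 Q" and Q_eq: "\<And>x. - laplacian Q x + Q x - \<bar>Q x\<bar> powr p * Q x = 0"
    using Q unfolding ground_state_def by blast
  define W where "W x = scaled_state p Q \<omega> x" for x
  define W1 where "W1 i x = \<kappa> * (\<rho> * partial_deriv i Q (\<rho> *\<^sub>R x))" for i x
  define W2 where "W2 i j x = \<kappa> * (\<rho> * (\<rho> * partial_deriv j (partial_deriv i Q) (\<rho> *\<^sub>R x)))" for i j x
  have W: "C2_with W W1 W2"
    using C2_with_linear[OF bounded_linear_mult_right C2_with_scale_arg[OF Ck2_imp_C2_with[OF Q2]], of \<kappa> \<rho>]
    unfolding W_def[abs_def] W1_def[abs_def] W2_def[abs_def] scaled_state_def \<kappa>_def \<rho>_def by simp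
  define z1 z2 where "z1 t i = partial_deriv i (z t)" and "z2 t i j = partial_deriv j (partial_deriv i (z t))" for t i j
  have z: "C2_with (z t) (z1 t) (z2 t)" for t
    using Ck2_imp_C2_with[of "z t"] smooth[of t] by (simp add: smooth_def z1_def[abs_def] z2_def[abs_def])
  have z_bounds: "cmod (z t x) \<le> C * exp (- \<gamma> * norm x)" "cmod (z1 t i x) \<le> C * exp (- \<gamma> * norm x)"
    "cmod (z2 t i j x) \<le> C * exp (- \<gamma> * norm x)" for t x i j
    using dec[of "[]" t x] dec[of "[i]" t x] dec[of "[j, i]" t x]
    by (simp_all add: multi_deriv_def z1_def z2_def)
  define e where "e t = exp (\<i> * complex_of_real (\<omega> * t))" for t
  have e: "cmod (e t) = 1" for t by (simp add: e_def)
  define D where "D t i x = e t * (complex_of_real (W1 i x) + z1 t i x)" for t i x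
  define H where "H t i j x = e t * (complex_of_real (W2 i j x) + z2 t i j x)" for t i j x
  have u: "C2_with (u t) (D t) (H t)" for t
    using C2_with_linear[OF bounded_linear_mult_right C2_with_add[OF C2_with_linear[OF bounded_linear_of_real W] z], of "e t" t]
    unfolding u_eq[abs_def] D_def[abs_def] H_def[abs_def] e_def W_def by simp
  have lap: "laplacian (u t) x = (\<Sum>j\<in>UNIV. H t j j x)" for t x
  proof -
    have "C2_with (u t) (\<lambda>i. partial_deriv i (u t)) (\<lambda>i j. partial_deriv j (partial_deriv i (u t)))"
      using sol by (intro Ck2_imp_C2_with) (simp add: defocusing_NLS_solution_def)
    from C2_with_unique(2)[OF this u] show ?thesis
      by (simp add: laplacian_def)
  qed
  define T where "T t x = vector_derivative (\<lambda>s. u s x) (at t)" for t x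
  have T: "((\<lambda>s. u s x) has_vector_derivative T t x) (at t)" for t x
    using sol unfolding T_def defocusing_NLS_solution_def by (simp add: vector_derivative_works[symmetric])
  have eq: "\<i> * T t x + (\<Sum>j\<in>UNIV. H t j j x) = norm (u t x) powr p *\<^sub>R u t x" for t x
    using sol unfolding T_def lap[symmetric] defocusing_NLS_solution_def by (simp add: scaleR_conv_of_real)
  define \<gamma>' where "\<gamma>' = min \<gamma> (\<gamma>1 * \<rho>)"
  have \<gamma>': "\<gamma>' > 0" using pos C1 \<kappa>\<rho> by (simp add: \<gamma>'_def)
  have exp1: "exp (- \<gamma> * norm x) \<le> exp (- \<gamma>' * norm x)"
    and exp2: "exp (- \<gamma>1 * norm (\<rho> *\<^sub>R x)) \<le> exp (- \<gamma>' * norm x)" for x :: "real^'n"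
  proof -
    have "\<gamma>' * norm x \<le> \<gamma> * norm x" "\<gamma>' * norm x \<le> \<gamma>1 * \<rho> * norm x"
      by (auto simp: \<gamma>'_def intro!: mult_right_mono)
    then show "exp (- \<gamma> * norm x) \<le> exp (- \<gamma>' * norm x)" "exp (- \<gamma>1 * norm (\<rho> *\<^sub>R x)) \<le> exp (- \<gamma>' * norm x)"
      using \<kappa>\<rho> by (simp_all add: mult.assoc)
  qed
  have Q_bound: "\<bar>Q (\<rho> *\<^sub>R x)\<bar> \<le> C1 * exp (- \<gamma>' * norm x)" for x
    using Q_decay[of "\<rho> *\<^sub>R x"] mult_left_mono[OF exp2, of C1 x] C1 by linarith
  have z_bound: "C * exp (- \<gamma> * norm x) \<le> C * exp (- \<gamma>' * norm x)" for x :: "real^'n"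
    using exp1[of x] pos by simp
  define n where "n = real CARD('n)"
  define C' where "C' = \<kappa> * C1 + C + (\<kappa> * \<omega> * ((1 + C1 powr p) * C1) + n * C)"
  have C': "C' > 0" unfolding C'_def n_def using \<kappa>\<rho> C1 pos by (intro add_pos_nonneg) auto
  have parts: "(\<kappa> * C1 + C) * E \<le> C' * E" "(\<kappa> * \<omega> * ((1 + C1 powr p) * C1) + n * C) * E \<le> C' * E" if "E \<ge> 0" for E
    using that \<kappa>\<rho> C1 pos by (auto simp: C'_def n_def intro!: mult_right_mono)
  have ub: "norm (u t x) \<le> C' * exp (- \<gamma>' * norm x)" for t x
  proof -
    have "norm (u t x) = norm (complex_of_real (W x) + z t x)"
      unfolding u_eq W_def e_def[symmetric] norm_mult e by simp
    also have "\<dots> \<le> \<bar>W x\<bar> + norm (z t x)"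
      using norm_triangle_ineq[of "complex_of_real (W x)" "z t x"] by simp
    also have "\<dots> \<le> \<kappa> * (C1 * exp (- \<gamma>' * norm x)) + C * exp (- \<gamma>' * norm x)"
    proof (rule add_mono)
      show "\<bar>W x\<bar> \<le> \<kappa> * (C1 * exp (- \<gamma>' * norm x))"
        using mult_left_mono[OF Q_bound, of \<kappa> x] \<kappa>\<rho>
        by (simp add: W_def scaled_state_def \<kappa>_def[symmetric] \<rho>_def[symmetric] abs_mult)
      show "norm (z t x) \<le> C * exp (- \<gamma>' * norm x)"
        using z_bounds(1) z_bound by (rule order_trans)
    qed
    also have "\<dots> = (\<kappa> * C1 + C) * exp (- \<gamma>' * norm x)" by (simp add: algebra_simps)
    also have "\<dots> \<le> C' * exp (- \<gamma>' * norm x)" by (rule parts) simp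
    finally show ?thesis .
  qed
  have lapQ: "\<bar>laplacian Q (\<rho> *\<^sub>R x)\<bar> \<le> (1 + C1 powr p) * C1 * exp (- \<gamma>' * norm x)" for x
  proof -
    define y where "y = \<rho> *\<^sub>R x"
    have "\<bar>Q y\<bar> \<le> C1"
      using Q_decay[of y] mult_left_le[of "exp (- \<gamma>1 * norm y)" C1] C1 by (auto intro: order_trans)
    then have q: "\<bar>Q y\<bar> powr p \<le> C1 powr p"
      using assms(1) by (intro powr_mono2) auto
    have "laplacian Q y = (1 - \<bar>Q y\<bar> powr p) * Q y"
      using Q_eq[of y] by (simp add: algebra_simps)
    then have "\<bar>laplacian Q y\<bar> = \<bar>1 - \<bar>Q y\<bar> powr p\<bar> * \<bar>Q y\<bar>"
      by (simp add: abs_mult)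
    also have "\<dots> \<le> (1 + C1 powr p) * (C1 * exp (- \<gamma>' * norm x))"
    proof (rule mult_mono)
      have "0 \<le> \<bar>Q y\<bar> powr p" by simp
      then show "\<bar>1 - \<bar>Q y\<bar> powr p\<bar> \<le> 1 + C1 powr p" using q by linarith
      show "\<bar>Q y\<bar> \<le> C1 * exp (- \<gamma>' * norm x)" unfolding y_def by (rule Q_bound)
    qed (auto simp: add_nonneg_nonneg)
    finally show ?thesis by (simp add: y_def mult.assoc)
  qed
  have Lb: "norm (\<Sum>j\<in>UNIV. H t j j x) \<le> C' * exp (- \<gamma>' * norm x)" for t x
  proof -
    have "(\<Sum>j\<in>UNIV. H t j j x) = e t * (complex_of_real (\<Sum>j\<in>UNIV. W2 j j x) + (\<Sum>j\<in>UNIV. z2 t j j x))"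
      by (simp add: H_def sum_distrib_left[symmetric] sum.distrib)
    also have "(\<Sum>j\<in>UNIV. W2 j j x) = \<kappa> * \<omega> * laplacian Q (\<rho> *\<^sub>R x)"
      by (simp add: W2_def laplacian_def sum_distrib_left mult.assoc flip: \<kappa>\<rho>(3))
    finally have "norm (\<Sum>j\<in>UNIV. H t j j x) \<le> \<bar>\<kappa> * \<omega> * laplacian Q (\<rho> *\<^sub>R x)\<bar> + norm (\<Sum>j\<in>UNIV. z2 t j j x)"
      using norm_triangle_ineq[of "complex_of_real (\<kappa> * \<omega> * laplacian Q (\<rho> *\<^sub>R x))" "\<Sum>j\<in>UNIV. z2 t j j x"]
      by (simp only: norm_mult e norm_of_real)
    also have "\<dots> \<le> \<kappa> * \<omega> * ((1 + C1 powr p) * C1 * exp (- \<gamma>' * norm x)) + n * (C * exp (- \<gamma>' * norm x))"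
    proof (rule add_mono)
      show "\<bar>\<kappa> * \<omega> * laplacian Q (\<rho> *\<^sub>R x)\<bar> \<le> \<kappa> * \<omega> * ((1 + C1 powr p) * C1 * exp (- \<gamma>' * norm x))"
        using mult_left_mono[OF lapQ, of "\<kappa> * \<omega>" x] \<kappa>\<rho>(1) pos(1) by (simp add: abs_mult)
      have "norm (\<Sum>j\<in>UNIV. z2 t j j x) \<le> (\<Sum>j\<in>(UNIV::'n set). C * exp (- \<gamma>' * norm x))"
        by (rule sum_norm_le) (rule order_trans[OF z_bounds(3) z_bound])
      then show "norm (\<Sum>j\<in>UNIV. z2 t j j x) \<le> n * (C * exp (- \<gamma>' * norm x))"
        by (simp add: n_def)
    qed
    also have "\<dots> = (\<kappa> * \<omega> * ((1 + C1 powr p) * C1) + n * C) * exp (- \<gamma>' * norm x)"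
      by (simp add: algebra_simps)
    also have "\<dots> \<le> C' * exp (- \<gamma>' * norm x)" by (rule parts) simp
    finally show ?thesis .
  qed
  have C_bound: "C * exp (- \<gamma> * norm x) \<le> C" for x :: "real^'n"
    using pos by (intro mult_left_le) auto
  have G: "norm (D t k x) \<le> \<bar>W1 k x\<bar> + C" for t x
  proof -
    have "norm (D t k x) \<le> \<bar>W1 k x\<bar> + norm (z1 t k x)"
      unfolding D_def norm_mult e using norm_triangle_ineq[of "complex_of_real (W1 k x)" "z1 t k x"] by simp
    then show ?thesis using z_bounds(2)[of t k x] C_bound[of x] by linarith
  qed
  have G_cont: "continuous_on UNIV (\<lambda>x. \<bar>W1 k x\<bar> + C)"
    by (intro continuous_intros C2_withD(4)[OF W])
  have e_cont: "isCont e t" for t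
    unfolding e_def[abs_def] by (intro continuous_intros)
  have z_cont: "isCont (\<lambda>s. z s x) t" for t x
  proof -
    have "z s x = u s x / e s - complex_of_real (W x)" for s
      unfolding u_eq W_def e_def by simp
    moreover have "isCont (\<lambda>s. u s x / e s - complex_of_real (W x)) t"
      by (intro continuous_intros has_vector_derivative_continuous[OF T] e_cont) (simp add: e_def)
    ultimately show ?thesis by simp
  qed
  have z1_cont: "isCont (\<lambda>s. z1 s k x) t" for t x
    by (rule isCont_partial_of_bounded_second[OF C2_withD(1)[OF z] C2_withD(2)[OF z] order_trans[OF z_bounds(3) C_bound] z_cont])
  have D_cont: "isCont (\<lambda>s. D s k x) t" for t x
    unfolding D_def by (intro continuous_intros e_cont z1_cont)
  have "u t x = 0" for t x
    by (rule periodic_decaying_solution_eq_0[OF assms(1) C' \<gamma>' _ u T eq ub Lb G G_cont D_cont per])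
       (use pos in simp)
  with nonzero show False by blast
qed

end
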